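(* Let $W$ be one of the groups $S_n$ ($n\ge 1$), $S^B_n$ ($n \ge 1$), $\widetilde{S}_n$ ($n\ge 2$), or $\widetilde{S}^C_n$ ($n \ge 1$), and let $w\in W$. The following are equivalent: (A) $\mathrm{dis}(w)/2 = \ell_S(w)$; (B) in every reduced word for $w$, for every $i\in[n-1]=\{1,\dots,n-1\}$, between every two copies of the letter $i$ there is a copy of the letter $i-1$ and a copy of the letter $i+1$; (C) $w$ globally avoids the pattern $321$. Moreover, if $W$ is nondegenerate (i.e. $W$ is $S_n$ with $n\ge1$, $S^B_n$ with $n\ge 1$, $\widetilde{S}_n$ with $n\ge 3$, or $\widetilde{S}^C_n$ with $n\ge 2$), these are also equivalent to (B$'$) no reduced word for $w$ contains consecutive letters $i\,(i+1)\,i$ or $i\,(i-1)\,i$ for any $i\in[n-1]$.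
   Context: All groups act by bijections on $\mathbb{Z}$ (or a subset); $n$ is the window size. - $S_n$: permutations of $[n]=\{1,\dots,n\}$. Unfrozen integers: $[n]$. - $S^B_n$: bijections $w$ of $\{-n,\dots,n\}$ with $w(-i)=-w(i)$ (so $w(0)=0$). Unfrozen integers: $\{\pm1,\dots,\pm n\}$. - $\widetilde{S}_n$: bijections $w:\mathbb{Z}\to\mathbb{Z}$ with $w(i+n)=w(i)+n$ for all $i$ and $\sum_{i=1}^n w(i)=\binom{n+1}{2}$. Unfrozen integers: all of $\mathbb{Z}$. - $\widetilde{S}^C_n$: bijections $w:\mathbb{Z}\to\mathbb{Z}$ with $w(-i)=-w(i)$ and $w(2(n+1)-i)=2(n+1)-w(i)$ for all $i$ (so $w$ fixes every multiple of $n+1$). Unfrozen integers: $\mathbb{Z}\setminus(n+1)\mathbb{Z}$. Integers that are not unfrozen (e.g. $0$ for $S^B_n$, multiples of $n+1$ for $\widetilde{S}^C_n$) are fixed by every element ("frozen"). Generators (simple transpositions), where each transposition is extended to all its images under the symmetries the group respects: $s_i$ swaps $i$ and $i+1$ for $1\le i\le n-1$ (in all four groups); in $\widetilde{S}_n$ additionally $s_0=s_n$ swaps $0$ and $1$ (equivalently $n$ and $n+1$), and letters $0$ and $n$ denote the same generator; in $S^B_n$ and $\widetilde{S}^C_n$ additionally $s_0$ swaps $-1$ and $1$; in $\widetilde{S}^C_n$ additionally $s_n$ swaps $n$ and $n+2$. For instance, in $\widetilde{S}^C_n$, $s_i$ ($1\le i\le n-1$) swaps $i+2k(n+1)\leftrightarrow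 i+1+2k(n+1)$ and $-i+2k(n+1)\leftrightarrow -i-1+2k(n+1)$ for all $k\in\mathbb{Z}$. These form Coxeter generating sets; $\ell_S(w)$ is the minimum length of a word in the generators equal to $w$, and a reduced word for $w$ is a word $i_1\cdots i_\ell$ with $w=s_{i_1}\cdots s_{i_\ell}$ and $\ell=\ell_S(w)$. A letter that does not index a generator of $W$ never occurs. Disarray: $\mathrm{dis}(w)=\sum_{i=1}^n |w(i)-i|$. $w$ globally contains $321$ if there are unfrozen integers $i<j<k$ with $w(i)>w(j)>w(k)$; otherwise $w$ globally avoids $321$. *)

theory Defs
  imports
    Complex_Main
    "HOL-Library.Sublist"
    "HOL-Number_Theory.Cong"
    "HOL-Combinatorics.Permutations"
begin

text \<open>
  The constructors stand for $S_n$, $S^B_n$, $\widetilde S_n$ and $\widetilde S^C_n$. In all four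
  cases the elements are represented as bijections of the integers; permutations of a finite
  set of integers are extended by the identity, as in \<^const>\<open>permutes\<close>.
\<close>

datatype family = SymA | SymB | AffA | AffC

fun elements :: "family \<Rightarrow> nat \<Rightarrow> (int \<Rightarrow> int) set" where
  "elements SymA n = {w. w permutes {1..int n}}"
| "elements SymB n = {w. w permutes {- int n..int n} \<and> (\<forall>i. w (- i) = - w i)}"
| "elements AffA n =
     {w. bij w \<and> (\<forall>i. w (i + int n) = w i + int n) \<and>
         (\<Sum>i = 1..int n. w i) = int ((n + 1) choose 2)}"
| "elements AffC n =
     {w. bij w \<and> (\<forall>i. w (- i) = - w i) \<and>
         (\<forall>i. w (2 * (int n + 1) - i) = 2 * (int n + 1) - w i)}"

fun unfrozen :: "family \<Rightarrow> nat \<Rightarrow> int set" where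
  "unfrozen SymA n = {1..int n}"
| "unfrozen SymB n = {- int n..int n} - {0}"
| "unfrozen AffA n = UNIV"
| "unfrozen AffC n = {i. \<not> (int n + 1) dvd i}"

fun admissible :: "family \<Rightarrow> nat \<Rightarrow> bool" where
  "admissible SymA n \<longleftrightarrow> n \<ge> 1"
| "admissible SymB n \<longleftrightarrow> n \<ge> 1"
| "admissible AffA n \<longleftrightarrow> n \<ge> 2"
| "admissible AffC n \<longleftrightarrow> n \<ge> 1"

fun nondegenerate :: "family \<Rightarrow> nat \<Rightarrow> bool" where
  "nondegenerate SymA n \<longleftrightarrow> n \<ge> 1"
| "nondegenerate SymB n \<longleftrightarrow> n \<ge> 1"
| "nondegenerate AffA n \<longleftrightarrow> n \<ge> 3"
| "nondegenerate AffC n \<longleftrightarrow> n \<ge> 2"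

text \<open>
  The alphabet indexes the generators. In the family \<^const>\<open>AffA\<close> the letters $0$ and $n$ denote
  the same generator, and $0$ is chosen as its name; \<open>letter\<close> renames $n$ to $0$ in this family,
  so that the successor of the letter $n - 1$ is $0$.
\<close>

fun alphabet :: "family \<Rightarrow> nat \<Rightarrow> nat set" where
  "alphabet SymA n = {1..<n}"
| "alphabet SymB n = {0..<n}"
| "alphabet AffA n = {0..<n}"
| "alphabet AffC n = {0..n}"

definition letter :: "family \<Rightarrow> nat \<Rightarrow> nat \<Rightarrow> nat" where
  "letter W n i = (if W = AffA \<and> i = n then 0 else i)"

text \<open>Swap $a + kN$ and $b + kN$ for all $k$; meaningful when $a$, $b$ are incongruent modulo $N$.\<close>

definition periodic_swap :: "int \<Rightarrow> int \<Rightarrow> int \<Rightarrow> int \<Rightarrow> int" where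
  "periodic_swap N a b x =
     (if [x = a] (mod N) then x + (b - a) else if [x = b] (mod N) then x + (a - b) else x)"

fun generator :: "family \<Rightarrow> nat \<Rightarrow> nat \<Rightarrow> int \<Rightarrow> int" where
  "generator SymA n i = Transposition.transpose (int i) (int i + 1)"
| "generator SymB n i =
     (if i = 0 then Transposition.transpose (- 1) 1
      else Transposition.transpose (int i) (int i + 1) \<circ>
           Transposition.transpose (- int i) (- int i - 1))"
| "generator AffA n i = periodic_swap (int n) (int i) (int i + 1)"
| "generator AffC n i =
     (if i = 0 then periodic_swap (2 * (int n + 1)) (- 1) 1
      else if i = n then periodic_swap (2 * (int n + 1)) (int n) (int n + 2)
      else periodic_swap (2 * (int n + 1)) (int i) (int i + 1) \<circ>
           periodic_swap (2 * (int n + 1)) (- int i) (- int i - 1))"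

definition word_prod :: "family \<Rightarrow> nat \<Rightarrow> nat list \<Rightarrow> int \<Rightarrow> int" where
  "word_prod W n u = foldr (\<lambda>i f. generator W n i \<circ> f) u id"

definition word_for :: "family \<Rightarrow> nat \<Rightarrow> nat list \<Rightarrow> (int \<Rightarrow> int) \<Rightarrow> bool" where
  "word_for W n u w \<longleftrightarrow> set u \<subseteq> alphabet W n \<and> word_prod W n u = w"

definition coxeter_length :: "family \<Rightarrow> nat \<Rightarrow> (int \<Rightarrow> int) \<Rightarrow> nat" where
  "coxeter_length W n w = (LEAST l. \<exists>u. word_for W n u w \<and> length u = l)"

definition reduced_word :: "family \<Rightarrow> nat \<Rightarrow> nat list \<Rightarrow> (int \<Rightarrow> int) \<Rightarrow> bool" where
  "reduced_word W n u w \<longleftrightarrow> word_for W n u w \<and> length u = coxeter_length W n w"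

definition disarray :: "nat \<Rightarrow> (int \<Rightarrow> int) \<Rightarrow> int" where
  "disarray n w = (\<Sum>i = 1..int n. \<bar>w i - i\<bar>)"

definition globally_contains_321 :: "family \<Rightarrow> nat \<Rightarrow> (int \<Rightarrow> int) \<Rightarrow> bool" where
  "globally_contains_321 W n w \<longleftrightarrow>
     (\<exists>i \<in> unfrozen W n. \<exists>j \<in> unfrozen W n. \<exists>k \<in> unfrozen W n.
        i < j \<and> j < k \<and> w i > w j \<and> w j > w k)"

definition occurs_between :: "nat \<Rightarrow> nat list \<Rightarrow> nat \<Rightarrow> nat \<Rightarrow> bool" where
  "occurs_between a u p q \<longleftrightarrow> (\<exists>r. p < r \<and> r < q \<and> u ! r = a)"

definition copies_separated :: "family \<Rightarrow> nat \<Rightarrow> nat list \<Rightarrow> bool" where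
  "copies_separated W n u \<longleftrightarrow>
     (\<forall>i \<in> {1..n - 1}. \<forall>p q. p < q \<and> q < length u \<and> u ! p = i \<and> u ! q = i \<longrightarrow>
        occurs_between (letter W n (i - 1)) u p q \<and>
        occurs_between (letter W n (i + 1)) u p q)"

text \<open>\<^const>\<open>sublist\<close> is the contiguous sublist relation.\<close>

definition braid_free :: "family \<Rightarrow> nat \<Rightarrow> nat list \<Rightarrow> bool" where
  "braid_free W n u \<longleftrightarrow>
     (\<forall>i \<in> {1..n - 1}. \<not> sublist [i, letter W n (i + 1), i] u \<and>
        \<not> sublist [i, letter W n (i - 1), i] u)"

end

(*
  All four groups consist of bijections of the integers that commute with a group of translations
  and reflections, and every generator swaps the orbits of two adjacent unfrozen positions l < r.
  Deleting the letter that swaps the values at l and r gives the exchange property, so w s_i is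
  shorter than w iff w(l) > w(r). Multiplication by such an s_i lowers half of the disarray by 1 if
  w(l) >= r and w(r) <= l, and leaves it unchanged otherwise; hence (A) says that every step of a
  reduced word crosses the cut between l and r. As many values cross a cut upwards as downwards,
  so a step that does not cross yields a third value and a 321, and conversely a crossing step
  does not create the first 321: this is (A) <-> (C). If all steps cross, the value at position i
  must fall back below the cut before i can occur again, and likewise the value at i+1 must rise,
  which requires the letters i-1 and i+1: (A) -> (B). For (B') -> (C) take a shortest w that
  contains 321. Every descent of w takes part in every 321, which leaves only three decreasing
  adjacent positions or a 4231 that is symmetric under a reflection; both give a reduced word
  that ends in i j i for neighbouring letters i and j.
*)

theory Submission
  imports Defs
begin

section \<open>Maps that commute with translations and reflections\<close>

text \<open>The families differ only in the period \<open>N\<close>, in the presence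
  \<open>R\<close> of reflections and in the unfrozen set \<open>U\<close>, so 321 patterns are
  studied once, for arbitrary adjacent pairs instead of letters; \<open>adjacent_pair_image\<close>
  leads back to letters. The obstacle is that a generator acts on all images of its pair at once.
  Near the centre of a reflection, the swap of \<open>p\<close>, \<open>q\<close> may also move the
  next position: in \<open>SymB\<close> the letter 1 swaps both -2, -1 and 1, 2. Every local
  computation has to exclude or handle such overlaps, and they are the source of the symmetric 4231.
  Translations are harmless: positions that differ by a period are never inverted. Balance is needed
  only as an existence statement: something crosses a cut upwards iff something crosses it
  downwards. In the infinite groups it rests on \<open>w x - x\<close> having sum 0 over a period,
  which \<open>AffA\<close> imposes and which follows from oddness in \<open>AffC\<close>. The cycle
  through (B') closes only in nondegenerate groups. In the degenerate ones two classes of unfrozen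
  positions are too few for a 321, so (C) always holds.\<close>

text \<open>
  The maps $x \mapsto e x + k$ that commute with all elements of a family. The families of finite groups
  have \<open>N = 0\<close>, which forces \<open>k = 0\<close>.
\<close>

definition symmetry :: "int \<Rightarrow> bool \<Rightarrow> int \<Rightarrow> int \<Rightarrow> bool" where
  "symmetry N R e k \<longleftrightarrow> N dvd k \<and> (e = 1 \<or> R \<and> e = - 1)"

text \<open>The second assumption keeps the centres of the reflections out of \<open>U\<close>: 0
  for \<open>SymB\<close>, the multiples of n+1 for \<open>AffC\<close>. Thus no unfrozen position
  is its own mirror image.\<close>

locale orbits =
  fixes N :: int and R :: bool and U :: "int set"
  assumes U_closed: "symmetry N R e k \<Longrightarrow> x \<in> U \<Longrightarrow> e * x + k \<in> U"
    and U_no_fixpoint: "symmetry N R (- 1) k \<Longrightarrow> x \<in> U \<Longrightarrow> 2 * x \<noteq> k"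
begin

abbreviation "symm e k \<equiv> symmetry N R e k"

definition equivariant :: "(int \<Rightarrow> int) \<Rightarrow> bool" where
  "equivariant w \<longleftrightarrow> (\<forall>e k x. symm e k \<longrightarrow> w (e * x + k) = e * w x + k)"

text \<open>Betweenness is tested in \<open>U\<close> only, so that -1, 1 and n, n+2, which straddle
  a frozen integer, count like i, i+1.\<close>

definition adjacent :: "int \<Rightarrow> int \<Rightarrow> bool" where
  "adjacent a b \<longleftrightarrow> a \<in> U \<and> b \<in> U \<and> a < b \<and> (\<forall>x\<in>U. \<not> (a < x \<and> x < b))"

text \<open>A reflection reverses the order, so the endpoints trade places and the image is again
  listed from left to right. A descent then reads the same on every image.\<close>

definition pair_image :: "int \<Rightarrow> int \<Rightarrow> int \<Rightarrow> int \<Rightarrow> bool" where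
  "pair_image a b x y \<longleftrightarrow>
     (\<exists>k. symm 1 k \<and> x = a + k \<and> y = b + k) \<or> (\<exists>k. symm (- 1) k \<and> x = k - b \<and> y = k - a)"

text \<open>This determines \<open>t\<close>: equivariance extends the exchange of \<open>a\<close>
  and \<open>b\<close> to all images, and the last clause fixes everything else.\<close>

definition swaps :: "(int \<Rightarrow> int) \<Rightarrow> int \<Rightarrow> int \<Rightarrow> bool" where
  "swaps t a b \<longleftrightarrow> equivariant t \<and> t a = b \<and> t b = a \<and>
     (\<forall>x. (\<forall>e k. symm e k \<longrightarrow> x \<noteq> e * a + k \<and> x \<noteq> e * b + k) \<longrightarrow> t x = x)"

definition pattern_321 :: "(int \<Rightarrow> int) \<Rightarrow> int \<Rightarrow> int \<Rightarrow> int \<Rightarrow> bool" where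
  "pattern_321 w a b c \<longleftrightarrow>
     a \<in> U \<and> b \<in> U \<and> c \<in> U \<and> a < b \<and> b < c \<and> w a > w b \<and> w b > w c"

definition compatible :: "(int \<Rightarrow> int) \<Rightarrow> bool" where
  "compatible w \<longleftrightarrow> equivariant w \<and> bij w \<and> (\<forall>x\<in>U. w x \<in> U)"

section \<open>Calculus of symmetries, image pairs and swaps\<close>

lemma sym_comp: "symm e k \<Longrightarrow> symm e' k' \<Longrightarrow> symm (e * e') (e * k' + k)"
  by (auto simp: symmetry_def)

lemma sym_inverse: "symm e k \<Longrightarrow> symm e (- e * k)"
  by (auto simp: symmetry_def)

lemma sym_cases:
  assumes "symm e k"
  obtains "e = 1" "symm 1 k" | "e = - 1" "symm (- 1) k"
  using assms by (auto simp: symmetry_def)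

lemma equivariantD: "equivariant w \<Longrightarrow> symm e k \<Longrightarrow> w (e * x + k) = e * w x + k"
  by (simp add: equivariant_def)

lemma equivariant_translation: "equivariant w \<Longrightarrow> symm 1 k \<Longrightarrow> w (x + k) = w x + k"
  using equivariantD[of w 1 k x] by simp

lemma equivariant_reflection: "equivariant w \<Longrightarrow> symm (- 1) k \<Longrightarrow> w (k - x) = k - w x"
  using equivariantD[of w "- 1" k x] by simp

lemma equivariant_comp: "equivariant v \<Longrightarrow> equivariant w \<Longrightarrow> equivariant (v \<circ> w)"
  by (simp add: equivariant_def)

lemma equivariant_id: "equivariant id"
  by (simp add: equivariant_def)

lemma U_translation: "symm 1 k \<Longrightarrow> x \<in> U \<Longrightarrow> x + k \<in> U"
  using U_closed[of 1 k x] by simp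

lemma U_reflection: "symm (- 1) k \<Longrightarrow> x \<in> U \<Longrightarrow> k - x \<in> U"
  using U_closed[of "- 1" k x] by simp

lemma pair_image_sym: "pair_image a b x y \<Longrightarrow> pair_image x y a b"
  unfolding pair_image_def
proof (elim disjE exE conjE)
  fix k assume "symm 1 k" "x = a + k" "y = b + k"
  then show "(\<exists>k. symm 1 k \<and> a = x + k \<and> b = y + k) \<or> (\<exists>k. symm (- 1) k \<and> a = k - y \<and> b = k - x)"
    by (intro disjI1 exI[of _ "- k"]) (auto simp: symmetry_def)
qed auto

lemma pair_image_adjacent:
  assumes "pair_image a b x y" "adjacent a b"
  shows "adjacent x y"
  using assms(1) unfolding pair_image_def
proof (elim disjE exE conjE)
  fix k assume k: "symm 1 k" and xy: "x = a + k" "y = b + k"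
  have k': "symm 1 (- k)" using k by (simp add: symmetry_def)
  show ?thesis
    unfolding adjacent_def
  proof (intro conjI ballI)
    fix z assume "z \<in> U"
    then have "z + - k \<in> U" by (rule U_translation[OF k'])
    then show "\<not> (x < z \<and> z < y)" using assms(2) xy unfolding adjacent_def by force
  qed (use xy assms(2) U_translation[OF k] in \<open>auto simp: adjacent_def\<close>)
next
  fix k assume k: "symm (- 1) k" and xy: "x = k - b" "y = k - a"
  show ?thesis
    unfolding adjacent_def
  proof (intro conjI ballI)
    fix z assume "z \<in> U"
    then have "k - z \<in> U" by (rule U_reflection[OF k])
    then show "\<not> (x < z \<and> z < y)" using assms(2) xy unfolding adjacent_def by force
  qed (use xy assms(2) U_reflection[OF k] in \<open>auto simp: adjacent_def\<close>)
qed

lemma pair_image_descent: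
  assumes "equivariant w" "pair_image a b x y"
  shows "w x > w y \<longleftrightarrow> w a > w b"
  using assms(2) unfolding pair_image_def
  using equivariant_translation[OF assms(1)] equivariant_reflection[OF assms(1)] by auto

text \<open>A swap is tied to no particular representative of its orbit of pairs. Later arguments
  can thus work at the pair they meet rather than at the one that names the letter.\<close>

lemma swaps_image:
  assumes "swaps t a b" "pair_image a b x y"
  shows "swaps t x y"
proof -
  obtain f c where fc: "symm f c" "x = f * a + c \<and> y = f * b + c \<or> x = f * b + c \<and> y = f * a + c"
    using assms(2) unfolding pair_image_def
    by (metis (no_types, opaque_lifting) diff_conv_add_uminus add.commute mult_1 mult_minus1)
  have f: "f * f = 1" using fc(1) by (auto simp: symmetry_def)
  have eq: "equivariant t" and ab: "t a = b" "t b = a"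
    and fixed: "\<And>z. (\<And>e k. symm e k \<Longrightarrow> z \<noteq> e * a + k \<and> z \<noteq> e * b + k) \<Longrightarrow> t z = z"
    using assms(1) unfolding swaps_def by blast+
  have "t z = z" if *: "\<And>e k. symm e k \<Longrightarrow> z \<noteq> e * x + k \<and> z \<noteq> e * y + k" for z
  proof (rule fixed)
    fix e k assume ek: "symm e k"
    \<comment> \<open>The symmetry given by \<open>e\<close>, \<open>k\<close> after the inverse of
      the one given by \<open>f\<close>, \<open>c\<close>. Since \<open>f * f = 1\<close>, it sends
      \<open>f * a + c\<close> to \<open>e * a + k\<close>.\<close>
    have "symm (e * f) (e * (- f * c) + k)"
      by (rule sym_comp[OF ek sym_inverse[OF fc(1)]])
    from *[OF this] fc(2) f show "z \<noteq> e * a + k \<and> z \<noteq> e * b + k"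
      by (auto simp: algebra_simps)
  qed
  moreover have "t x = y \<and> t y = x"
    using fc(2) equivariantD[OF eq fc(1)] ab by auto
  ultimately show ?thesis
    using eq unfolding swaps_def by blast
qed

lemma swaps_involution:
  assumes "swaps t a b"
  shows "t (t x) = x"
proof (cases "\<exists>e k. symm e k \<and> (x = e * a + k \<or> x = e * b + k)")
  case True
  then show ?thesis using assms unfolding swaps_def by (auto simp: equivariantD)
next
  case False
  then have "t x = x" using assms unfolding swaps_def by blast
  then show ?thesis by simp
qed

lemma swaps_comp_self: "swaps t a b \<Longrightarrow> t \<circ> t = id"
  using swaps_involution by fastforce

lemma swaps_moved:
  assumes "swaps t a b" "t x \<noteq> x"
  shows "pair_image a b x (t x) \<or> pair_image a b (t x) x"
proof -
  obtain e k where ek: "symm e k" "x = e * a + k \<or> x = e * b + k"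
    using assms unfolding swaps_def by blast
  then have tx: "x = e * a + k \<and> t x = e * b + k \<or> x = e * b + k \<and> t x = e * a + k"
    using assms(1) unfolding swaps_def by (auto simp: equivariantD)
  from ek(1) show ?thesis
  proof (cases rule: sym_cases)
    case 1
    then show ?thesis using tx unfolding pair_image_def by auto
  next
    case 2
    then show ?thesis using tx unfolding pair_image_def by auto
  qed
qed

lemma swaps_moved_adjacent:
  assumes "swaps t a b" "adjacent a b"
  obtains "t x = x" | "adjacent x (t x)" "pair_image a b x (t x)"
  | "adjacent (t x) x" "pair_image a b (t x) x"
  using swaps_moved[OF assms(1)] pair_image_adjacent[OF _ assms(2)] by blast

lemma swaps_U:
  assumes "swaps t a b" "adjacent a b" "x \<in> U"
  shows "t x \<in> U"
  using assms by (metis adjacent_def swaps_moved_adjacent)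

lemma swaps_compatible:
  assumes "swaps t a b" "adjacent a b"
  shows "compatible t"
  using assms swaps_U[OF assms] swaps_involution[OF assms(1)]
  unfolding compatible_def swaps_def by (metis involuntory_imp_bij)

text \<open>\<open>t\<close> moves a point at most to its neighbour in \<open>U\<close>, so two
  points can pass each other only by trading places.\<close>

lemma swaps_inversion:
  assumes "swaps t a b" "adjacent a b" "x \<in> U" "y \<in> U" "x < y" "t x > t y"
  shows "pair_image a b x y"
proof (cases "t x = y")
  case True
  then show ?thesis
    using assms by (metis adjacent_def order.asym swaps_moved_adjacent order_less_irrefl)
next
  case False
  have *: "t x \<le> x \<or> adjacent x (t x)" "t y \<ge> y \<or> adjacent (t y) y"
    using swaps_moved_adjacent[OF assms(1,2)] by (metis adjacent_def order_le_less)+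
  have "t x \<in> U" "t y \<in> U" using swaps_U assms by blast+
  with * False assms show ?thesis
    unfolding adjacent_def by (smt (verit, best) swaps_involution)
qed

text \<open>Both sides agree on the orbits of \<open>p\<close> and \<open>q\<close> and leave all
  other points to \<open>u\<close>. This is the identity that lets \<open>exchange\<close> delete a
  letter.\<close>

lemma swaps_conjugate:
  assumes "compatible u" "swaps s p q" "swaps t (u p) (u q)"
  shows "u \<circ> s = t \<circ> u"
proof
  fix z
  have eu: "equivariant u" and inj: "inj u" using assms(1) by (auto simp: compatible_def bij_is_inj)
  have es: "equivariant s" and s: "s p = q" "s q = p" using assms(2) by (auto simp: swaps_def)
  have et: "equivariant t" and t: "t (u p) = u q" "t (u q) = u p" using assms(3) by (auto simp: swaps_def)
  show "(u \<circ> s) z = (t \<circ> u) z"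
  proof (cases "\<exists>e k. symm e k \<and> (z = e * p + k \<or> z = e * q + k)")
    case True
    then show ?thesis
      using s t by (auto simp: equivariantD[OF eu] equivariantD[OF es] equivariantD[OF et])
  next
    case False
    then have "s z = z" using assms(2) unfolding swaps_def by blast
    moreover have "t (u z) = u z"
    proof -
      have "u z \<noteq> e * u p + k \<and> u z \<noteq> e * u q + k" if "symm e k" for e k
        using False that by (metis equivariantD[OF eu that] injD[OF inj])
      then show ?thesis using assms(3) unfolding swaps_def by blast
    qed
    ultimately show ?thesis by simp
  qed
qed

text \<open>\<open>t\<close> carries inversions of \<open>w \<circ> t\<close> to inversions of
  \<open>w\<close>: a pair that it turned round would be an image of \<open>a\<close>,
  \<open>b\<close>, where \<open>w \<circ> t\<close> increases. So undoing a descent never creates a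
  321.\<close>

lemma pattern_321_swaps:
  assumes "compatible w" "swaps t a b" "adjacent a b" "w a > w b" "pattern_321 (w \<circ> t) x y z"
  shows "pattern_321 w (t x) (t y) (t z)"
proof -
  have e: "equivariant w" using assms(1) by (simp add: compatible_def)
  have *: "t u < t v" if "u \<in> U" "v \<in> U" "u < v" "w (t u) > w (t v)" for u v
  proof (rule ccontr)
    assume "\<not> ?thesis"
    then have "t u > t v" using that by (metis linorder_neqE order_less_irrefl)
    then have im: "pair_image a b u v"
      by (rule swaps_inversion[OF assms(2,3) that(1-3)])
    from swaps_image[OF assms(2) this] have "t u = v" "t v = u"
      by (auto simp: swaps_def)
    then show False
      using that(4) pair_image_descent[OF e im] assms(4) by simp
  qed
  show ?thesis
    using assms(5) * swaps_U[OF assms(2,3)] unfolding pattern_321_def by simp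
qed

text \<open>The three values are unchanged, so only the order of the positions can be lost, and this
  must happen at the first or at the last two of them.\<close>

lemma pattern_321_broken:
  assumes "swaps t a b" "adjacent a b" "pattern_321 w x y z"
    "\<not> pattern_321 (w \<circ> t) (t x) (t y) (t z)"
  shows "pair_image a b x y \<or> pair_image a b y z"
proof -
  have "\<not> (t x < t y \<and> t y < t z)"
    using assms(3,4) swaps_U[OF assms(1,2)] swaps_involution[OF assms(1)]
    unfolding pattern_321_def by auto
  moreover have "t x \<noteq> t y" "t y \<noteq> t z"
    using assms(3) swaps_involution[OF assms(1)] unfolding pattern_321_def
    by (metis order_less_irrefl)+
  ultimately show ?thesis
    using swaps_inversion[OF assms(1,2)] assms(3) unfolding pattern_321_def
    by (meson linorder_neqE)
qed

lemma descent_between: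
  assumes "x \<in> U" "y \<in> U" "x < y" "w x > (w y :: int)"
  obtains a b where "adjacent a b" "x \<le> a" "b \<le> y" "w a > w b"
  using assms
proof (induction "nat (y - x)" arbitrary: x y thesis rule: less_induct)
  case less
  show ?case
  proof (cases "adjacent x y")
    case True
    then show ?thesis using less.prems by blast
  next
    case False
    then obtain z where z: "z \<in> U" "x < z" "z < y"
      using less.prems unfolding adjacent_def by blast
    show ?thesis
    proof (cases "w x > w z")
      case True
      show ?thesis
        by (rule less.hyps[of z x]) (use z True less.prems in auto)
    next
      case False
      show ?thesis
        by (rule less.hyps[of y z]) (use z False less.prems in auto)
    qed
  qed
qed

section \<open>Minimal permutations that contain 321\<close>

text \<open>\<open>s\<close> may move \<open>c\<close> because it acts on all images of
  \<open>p\<close>, \<open>q\<close>. Translations are ruled out, as a translate further right has a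
  larger value. A reflection must be the one that exchanges \<open>q\<close> and \<open>c\<close>,
  as for -2, -1, 1 in \<open>SymB\<close>.\<close>

lemma moved_right_neighbour:
  assumes w: "equivariant w" and s: "swaps s p q" and pq: "adjacent p q" and qc: "adjacent q c"
    and desc: "w p > w q" "w q > w c" and moved: "s c \<noteq> c"
  obtains m where "symm (- 1) m" "c = m - q" "s c = m - p"
proof -
  from swaps_moved[OF s moved] consider
      k where "symm 1 k" "c = p + k" | k where "symm 1 k" "c = q + k"
    | k where "symm (- 1) k" "c = k - q" "s c = k - p"
    | k where "symm (- 1) k" "c = k - p" "s c = k - q"
    unfolding pair_image_def by blast
  then show thesis
  proof cases
    case (1 k)
    then show ?thesis using equivariant_translation[OF w, of k p] pq qc desc by (simp add: adjacent_def)
  next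
    case (2 k)
    then show ?thesis using equivariant_translation[OF w, of k q] pq qc desc by (simp add: adjacent_def)
  next
    case (3 k)
    then show ?thesis using that by blast
  next
    case (4 k)
    \<comment> \<open>\<open>k - q\<close> is unfrozen and below \<open>c\<close>, hence at most
      \<open>q\<close>; it is not \<open>q\<close>, hence at most \<open>p\<close>; but then
      \<open>c = k - p\<close> is at most \<open>q\<close>.\<close>
    have "k - q \<in> U" "2 * q \<noteq> k"
      using 4(1) pq U_reflection U_no_fixpoint by (auto simp: adjacent_def)
    then have False using 4 pq qc unfolding adjacent_def by (smt (verit))
    then show ?thesis ..
  qed
qed

lemma moved_left_neighbour:
  assumes w: "equivariant w" and t: "swaps t q c" and pq: "adjacent p q" and qc: "adjacent q c"
    and desc: "w p > w q" "w q > w c" and moved: "t p \<noteq> p"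
  obtains m where "symm (- 1) m" "p = m - q" "t p = m - c"
proof -
  from swaps_moved[OF t moved] consider
      k where "symm 1 k" "p = q + k" | k where "symm 1 k" "p = c + k"
    | k where "symm (- 1) k" "p = k - q" "t p = k - c"
    | k where "symm (- 1) k" "p = k - c" "t p = k - q"
    unfolding pair_image_def by blast
  then show thesis
  proof cases
    case (1 k)
    then show ?thesis using equivariant_translation[OF w, of k q] pq qc desc by (simp add: adjacent_def)
  next
    case (2 k)
    then show ?thesis using equivariant_translation[OF w, of k c] pq qc desc by (simp add: adjacent_def)
  next
    case (3 k)
    then show ?thesis using that by blast
  next
    case (4 k)
    have "k - q \<in> U" "2 * q \<noteq> k"
      using 4(1) pq U_reflection U_no_fixpoint by (auto simp: adjacent_def)
    then have False using 4 pq qc unfolding adjacent_def by (smt (verit))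
    then show ?thesis ..
  qed
qed

text \<open>Undoing s, t, s and undoing t, s, t are both needed: only one of the two letters is
  certain to lie in [n-1], and it must be the outer one. The case distinctions treat the overlaps in
  which \<open>s\<close> moves \<open>c\<close> or \<open>t\<close> moves \<open>p\<close>.\<close>

lemma triple_descents:
  assumes w: "equivariant w" and s: "swaps s p q" and t: "swaps t q c"
    and pq: "adjacent p q" and qc: "adjacent q c" and desc: "w p > w q" "w q > w c"
  shows "(w \<circ> s) q > (w \<circ> s) c" "(w \<circ> s \<circ> t) p > (w \<circ> s \<circ> t) q"
    "(w \<circ> t) p > (w \<circ> t) q" "(w \<circ> t \<circ> s) q > (w \<circ> t \<circ> s) c"
proof -
  have st: "s p = q" "s q = p" "t q = c" "t c = q" and e: "equivariant s" "equivariant t"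
    using s t by (auto simp: swaps_def)
  consider "s c = c" | m where "symm (- 1) m" "c = m - q" "s c = m - p"
    using moved_right_neighbour[OF w s pq qc desc] by blast
  note C = this
  consider "t p = p" | m where "symm (- 1) m" "p = m - q" "t p = m - c"
    using moved_left_neighbour[OF w t pq qc desc] by blast
  note P = this
  have less: "p < q" "q < c" using pq qc by (auto simp: adjacent_def)
  note refl = equivariant_reflection[OF w] equivariant_reflection[OF e(1)] equivariant_reflection[OF e(2)]
  have goals: "w p > w (s c)" "w (s (t p)) > w (s c)" "w (t p) > w c" "w (t p) > w (t (s c))"
  proof -
    show "w p > w (s c)"
      using C
    proof cases
      case (2 m)
      then show ?thesis using refl(1)[of m p] refl(1)[of m q] desc by simp
    qed (use desc in simp)
    show "w (t p) > w c"
      using P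
    proof cases
      case (2 m)
      then show ?thesis using refl(1)[of m c] refl(1)[of m q] desc by simp
    qed (use desc in simp)
    show "w (s (t p)) > w (s c)"
      using P
    proof cases
      case 1
      show ?thesis using C
      proof cases
        case (2 m)
        then show ?thesis using 1 st desc refl(1)[of m p] refl(1)[of m q] by simp
      qed (use 1 st desc in simp)
    next
      case P: (2 m)
      show ?thesis using C
      proof cases
        case 1
        then show ?thesis using P st desc refl(2)[of m c] refl(1)[of m c] refl(1)[of m q] by simp
      next
        \<comment> \<open>Both overlaps at once: \<open>p\<close> and \<open>c\<close> are mirror
          images of \<open>q\<close>, so \<open>c\<close> is a translate of \<open>p\<close> to the
          right and cannot have a smaller value.\<close>
        case (2 k)
        then show ?thesis using P st desc less refl(1)[of m q] refl(1)[of k q] by simp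
      qed
    qed
    show "w (t p) > w (t (s c))"
      using C
    proof cases
      case 1
      show ?thesis using P
      proof cases
        case (2 m)
        then show ?thesis using 1 st desc refl(1)[of m c] refl(1)[of m q] by simp
      qed (use 1 st desc in simp)
    next
      case C: (2 m)
      show ?thesis using P
      proof cases
        case 1
        then show ?thesis using C st desc refl(3)[of m p] refl(1)[of m p] refl(1)[of m q] by simp
      next
        case (2 k)
        then show ?thesis using C st desc less refl(1)[of m q] refl(1)[of k q] by simp
      qed
    qed
  qed
  show "(w \<circ> s) q > (w \<circ> s) c" "(w \<circ> s \<circ> t) p > (w \<circ> s \<circ> t) q"
    "(w \<circ> t) p > (w \<circ> t) q" "(w \<circ> t \<circ> s) q > (w \<circ> t \<circ> s) c"
    using goals st by simp_all
qed

definition descending_triple :: "(int \<Rightarrow> int) \<Rightarrow> int \<Rightarrow> int \<Rightarrow> int \<Rightarrow> bool" where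
  "descending_triple w p q c \<longleftrightarrow> adjacent p q \<and> adjacent q c \<and> w p > w q \<and> w q > w c"

text \<open>
  The pattern 4231 on \<open>p < q < m - q < m - p\<close>, for a reflection \<open>x \<mapsto> m - x\<close>. In the group
  $S^B_2$ it is the element $s_1 s_0 s_1$, which contains 321 although it is not the longest element.
\<close>

definition symmetric_4231 :: "(int \<Rightarrow> int) \<Rightarrow> int \<Rightarrow> int \<Rightarrow> int \<Rightarrow> bool" where
  "symmetric_4231 w m p q \<longleftrightarrow> symm (- 1) m \<and> adjacent p q \<and> adjacent q (m - q) \<and>
     w q < w (m - q) \<and> w (m - p) < w q"

lemma adjacent_predecessor:
  assumes "a \<in> U" "c \<in> U" "a < c"
  obtains x where "adjacent x c" "a \<le> x"
proof -
  define X where "X = {x \<in> U. a \<le> x \<and> x < c}"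
  define x where "x = Max X"
  have fin: "finite X" by (rule finite_subset[of _ "{a..c}"]) (auto simp: X_def)
  have "a \<in> X" using assms by (auto simp: X_def)
  then have "x \<in> X" unfolding x_def using fin by (intro Max_in) auto
  then have x: "x \<in> U" "a \<le> x" "x < c" by (auto simp: X_def)
  have "\<not> (x < z \<and> z < c)" if "z \<in> U" for z
  proof
    assume "x < z \<and> z < c"
    then have "z \<in> X" using that x by (simp add: X_def)
    then have "z \<le> x" unfolding x_def using fin by simp
    then show False using \<open>x < z \<and> z < c\<close> by simp
  qed
  then show ?thesis using that x assms(2) unfolding adjacent_def by blast
qed

lemma adjacent_successor:
  assumes "a \<in> U" "c \<in> U" "a < c"
  obtains x where "adjacent a x" "x \<le> c"
proof -
  define X where "X = {x \<in> U. a < x \<and> x \<le> c}"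
  define x where "x = Min X"
  have fin: "finite X" by (rule finite_subset[of _ "{a..c}"]) (auto simp: X_def)
  have "c \<in> X" using assms by (auto simp: X_def)
  then have "x \<in> X" unfolding x_def using fin by (intro Min_in) auto
  then have x: "x \<in> U" "a < x" "x \<le> c" by (auto simp: X_def)
  have "\<not> (a < z \<and> z < x)" if "z \<in> U" for z
  proof
    assume "a < z \<and> z < x"
    then have "z \<in> X" using that x by (simp add: X_def)
    then have "x \<le> z" unfolding x_def using fin by simp
    then show False using \<open>a < z \<and> z < x\<close> by simp
  qed
  then show ?thesis using that x assms(1) unfolding adjacent_def by blast
qed

text \<open>
  By \<open>pattern_321_broken\<close> this holds if undoing any descent of \<open>w\<close> leads to an element that avoids
  321, i.e. if \<open>w\<close> is minimal among the elements that contain 321.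
\<close>

definition unbreakable :: "(int \<Rightarrow> int) \<Rightarrow> bool" where
  "unbreakable w \<longleftrightarrow> (\<forall>x y a b c. adjacent x y \<and> w x > w y \<and> pattern_321 w a b c \<longrightarrow>
     pair_image x y a b \<or> pair_image x y b c)"

text \<open>Take the first \<open>c\<close> after \<open>q\<close> with a value below
  \<open>w q\<close>, and its predecessor \<open>x\<close>. If \<open>x\<close> is not
  \<open>q\<close>, the descent at \<open>x\<close>, \<open>c\<close> must be an image of
  \<open>p\<close>, \<open>q\<close>, because \<open>q\<close>, \<open>c\<close> are not adjacent.
  Translations would keep the order of \<open>q\<close> and \<open>c\<close>, so it is a mirror
  image, and this gives the symmetric 4231.\<close>

lemma unbreakable_321_left:
  assumes w: "compatible w" and breaks: "unbreakable w"
    and pq: "adjacent p q" and pat: "pattern_321 w p q d"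
  shows "(\<exists>p q c. descending_triple w p q c) \<or> (\<exists>m p q. symmetric_4231 w m p q)"
proof -
  have e: "equivariant w" and inj: "inj w" using w by (auto simp: compatible_def bij_is_inj)
  have wpq: "w p > w q" using pat by (simp add: pattern_321_def)
  have pqU: "p \<in> U" "q \<in> U" "p < q" using pq by (auto simp: adjacent_def)
  define X where "X = {c \<in> U. q < c \<and> c \<le> d \<and> w c < w q}"
  have fin: "finite X" by (rule finite_subset[of _ "{q..d}"]) (auto simp: X_def)
  have "d \<in> X" using pat by (auto simp: X_def pattern_321_def)
  then have "X \<noteq> {}" by auto
  define c where "c = Min X"
  have "c \<in> X" unfolding c_def using fin \<open>X \<noteq> {}\<close> by (rule Min_in)
  then have c: "c \<in> U" "q < c" "w c < w q" and cd: "c \<le> d" by (auto simp: X_def)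
  have between: "w x > w q" if "x \<in> U" "q < x" "x < c" for x
  proof -
    have "x \<notin> X" using that(3) fin unfolding c_def by (meson Min_le linorder_not_less)
    then have "\<not> w x < w q" using that cd by (auto simp: X_def)
    moreover have "w x \<noteq> w q" using inj that(2) by (metis injD order_less_irrefl)
    ultimately show ?thesis by simp
  qed
  obtain x where x: "adjacent x c" "q \<le> x" using adjacent_predecessor[OF pqU(2) c(1,2)] .
  show ?thesis
  proof (cases "x = q")
    case True
    then show ?thesis using x pq wpq c unfolding descending_triple_def by blast
  next
    case False
    then have xU: "x \<in> U" "q < x" "x < c" using x by (auto simp: adjacent_def)
    have wx: "w x > w q" by (rule between[OF xU])
    have "w x > w c" using wx c by simp
    then have breaks': "pair_image x c a b \<or> pair_image x c b d" if "pattern_321 w a b d" for a b d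
      using breaks x(1) that unfolding unbreakable_def by blast
    have "pattern_321 w p q c" using pqU c wpq by (simp add: pattern_321_def)
    from breaks'[OF this] have "pair_image x c p q"
      using pair_image_adjacent[OF _ x(1), of q c] xU by (auto simp: adjacent_def)
    then consider k where "symm 1 k" "p = x + k" "q = c + k"
      | m where "symm (- 1) m" "p = m - c" "q = m - x"
      unfolding pair_image_def by blast
    then show ?thesis
    proof cases
      case (1 k)
      then show ?thesis using equivariant_translation[OF e, of k c] c by simp
    next
      case (2 m)
      have wm: "w (m - z) = m - w z" for z by (rule equivariant_reflection[OF e 2(1)])
      have xm: "x = m - q" and cm: "c = m - p" using 2 by auto
      have "\<not> (q < y \<and> y < x)" if y: "y \<in> U" for y
      proof
        assume *: "q < y \<and> y < x"
        \<comment> \<open>The mirror image of \<open>y\<close> also lies between \<open>q\<close>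
          and \<open>x\<close>. Its value exceeds \<open>w q\<close>, hence \<open>w c\<close>,
          which reflects to \<open>w y < w p\<close>; the 321 at \<open>p\<close>, \<open>y\<close>,
          \<open>c\<close> then has no adjacent pair.\<close>
        have "m - y \<in> U" by (rule U_reflection[OF 2(1) y])
        then have "w y > w q" "w (m - y) > w q"
          using between[OF y] between[of "m - y"] * xm xU by auto
        then have "pattern_321 w p y c"
          using pqU y c(1) * xU c(3) wm[of y] wm[of p] cm by (simp add: pattern_321_def)
        from breaks'[OF this] have "adjacent p y \<or> adjacent y c"
          using pair_image_adjacent[OF _ x(1)] by blast
        then show False using * pqU xU unfolding adjacent_def by blast
      qed
      then have "adjacent q (m - q)" using pqU xU xm unfolding adjacent_def by blast
      then have "symmetric_4231 w m p q"
        using 2(1) pq wx c(3) unfolding symmetric_4231_def xm[symmetric] cm[symmetric] by blast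
      then show ?thesis by blast
    qed
  qed
qed

text \<open>Some descent exists, so the first or the last two positions are adjacent. With
  reflections, negation turns the second case into the first. Without them only translates of a pair
  occur, and the last larger value before \<open>b\<close> must stand right next to
  \<open>b\<close>.\<close>

lemma unbreakable_321:
  assumes w: "compatible w" and breaks: "unbreakable w" and pat: "pattern_321 w a b c"
  shows "(\<exists>p q c. descending_triple w p q c) \<or> (\<exists>m p q. symmetric_4231 w m p q)"
proof -
  have e: "equivariant w" and inj: "inj w" using w by (auto simp: compatible_def bij_is_inj)
  have U: "a \<in> U" "b \<in> U" "c \<in> U" "a < b" "b < c" "w a > w b" "w b > w c"
    using pat by (auto simp: pattern_321_def)
  obtain x y where "adjacent x y" "w x > w y"
    using descent_between[OF U(1,2,4,6)] by blast
  then have "pair_image x y a b \<or> pair_image x y b c"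
    using breaks pat unfolding unbreakable_def by blast
  then consider "adjacent a b" | "adjacent b c"
    using pair_image_adjacent \<open>adjacent x y\<close> by blast
  then show ?thesis
  proof cases
    case 1
    then show ?thesis using unbreakable_321_left[OF w breaks _ pat] by blast
  next
    case bc: 2
    show ?thesis
    proof (cases R)
      case True
      then have s: "symm (- 1) 0" by (simp add: symmetry_def)
      have "pattern_321 w (- c) (- b) (- a)"
        using U U_reflection[OF s] equivariant_reflection[OF e s] by (simp add: pattern_321_def)
      moreover have "pair_image b c (- c) (- b)"
        unfolding pair_image_def using s by force
      then have "adjacent (- c) (- b)" by (rule pair_image_adjacent[OF _ bc])
      ultimately show ?thesis using unbreakable_321_left[OF w breaks] by blast
    next
      case False
      then have no_reflection: "\<not> symm (- 1) k" for k by (simp add: symmetry_def)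
      define X where "X = {x \<in> U. a \<le> x \<and> x < b \<and> w x > w b}"
      have fin: "finite X" by (rule finite_subset[of _ "{a..b}"]) (auto simp: X_def)
      have "a \<in> X" using U by (auto simp: X_def)
      then have M: "Max X \<in> X" using fin by (intro Max_in) auto
      define p where "p = Max X"
      have p: "p \<in> U" "p < b" "w p > w b" "a \<le> p" using M by (auto simp: X_def p_def)
      obtain q where q: "adjacent p q" "q \<le> b" using adjacent_successor[OF p(1) U(2) p(2)] .
      have "q = b"
      proof (rule ccontr)
        assume "q \<noteq> b"
        then have "q < b" and "q \<in> U" and "p < q" using q by (auto simp: adjacent_def)
        have "q \<notin> X" using Max_ge[OF fin, of q] \<open>p < q\<close> by (auto simp: p_def)
        then have "\<not> w q > w b"
          using p(4) \<open>q < b\<close> \<open>q \<in> U\<close> \<open>p < q\<close> by (simp add: X_def)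
        then have "w q < w p" using p by simp
        moreover have "pattern_321 w p b c" using p U by (simp add: pattern_321_def)
        ultimately have "pair_image p q p b \<or> pair_image p q b c"
          using breaks q(1) unfolding unbreakable_def by blast
        then have "pair_image p q b c"
          using pair_image_adjacent[OF _ q(1), of p b] \<open>q < b\<close> \<open>q \<in> U\<close> \<open>p < q\<close>
          by (auto simp: adjacent_def)
        then obtain k where "symm 1 k" "b = p + k" "c = q + k"
          using no_reflection unfolding pair_image_def by blast
        then show False using equivariant_translation[OF e, of k p] p by simp
      qed
      then show ?thesis using q p bc U unfolding descending_triple_def by blast
    qed
  qed
qed

text \<open>After \<open>s\<close>, the values at \<open>q\<close> and \<open>m - q\<close> are the
  outer values \<open>w p\<close> and \<open>w (m - p)\<close>; \<open>t\<close> exchanges them, and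
  the smaller one then meets \<open>w q\<close>.\<close>

lemma symmetric_4231_descents:
  assumes w: "equivariant w" and s: "swaps s p q" and t: "swaps t q (m - q)"
    and quad: "symmetric_4231 w m p q"
  shows "w p > w q" "(w \<circ> s) q > (w \<circ> s) (m - q)" "(w \<circ> s \<circ> t) p > (w \<circ> s \<circ> t) q"
proof -
  have m: "symm (- 1) m" using quad by (simp add: symmetric_4231_def)
  have st: "s p = q" "s q = p" "t q = m - q" and e: "equivariant s" "equivariant t"
    using s t by (auto simp: swaps_def)
  have sm: "s (m - q) = m - p" using equivariant_reflection[OF e(1) m] st by simp
  note wm = equivariant_reflection[OF w m]
  have less: "p < q" "q < m - q" "w (m - q) > w q" "w (m - p) < w q"
    using quad by (auto simp: symmetric_4231_def adjacent_def)
  then show "w p > w q" "(w \<circ> s) q > (w \<circ> s) (m - q)" using st sm wm by simp_all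
  \<comment> \<open>Were \<open>p\<close> an image of \<open>q\<close> or \<open>m - q\<close>, a
    translation would contradict the order of the values, and a reflection the comparison of
    \<open>p + q\<close> with \<open>m\<close>.\<close>
  have "t p = p"
  proof (rule ccontr)
    assume "t p \<noteq> p"
    from swaps_moved[OF t this] consider
        k where "symm 1 k" "p = q + k" | k where "symm 1 k" "p = (m - q) + k"
      | k where "symm (- 1) k" "p = k - q" | k where "symm (- 1) k" "p = k - (m - q)"
      unfolding pair_image_def by blast
    then show False
    proof cases
      case (1 k)
      then show ?thesis using equivariant_translation[OF w 1(1), of q] less wm[of p] wm[of q] by simp
    next
      case (2 k)
      then show ?thesis
        using equivariant_translation[OF w 2(1), of "m - q"] less wm[of p] wm[of q] by simp
    next
      case (3 k)
      then show ?thesis using equivariant_reflection[OF w 3(1), of q] less wm[of p] wm[of q] by simp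
    next
      case (4 k)
      then show ?thesis
        using equivariant_reflection[OF w 4(1), of "m - q"] less wm[of p] wm[of q] by simp
    qed
  qed
  then show "(w \<circ> s \<circ> t) p > (w \<circ> s \<circ> t) q" using st sm less by simp
qed

section \<open>Generators\<close>

text \<open>Here \<open>N = 0\<close> is allowed: divisibility by 0 is equality, so the same lemma
  covers the transpositions of the finite groups.\<close>

lemma swaps_periodic_swap:
  assumes "\<not> R" and ab: "\<not> N dvd (b - a)"
  shows "swaps (periodic_swap N a b) a b"
proof -
  have "equivariant (periodic_swap N a b)"
    unfolding equivariant_def
  proof (intro allI impI)
    fix e k x assume s: "symm e k"
    have "N dvd k" "e = 1" using s assms(1) by (auto simp: symmetry_def)
    have "N dvd (x + k - c) \<longleftrightarrow> N dvd (x - c)" for c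
      using dvd_add_left_iff[OF \<open>N dvd k\<close>, of "x - c"] by (simp add: algebra_simps)
    then show "periodic_swap N a b (e * x + k) = e * periodic_swap N a b x + k"
      using \<open>e = 1\<close> by (simp add: periodic_swap_def cong_iff_dvd_diff)
  qed
  moreover have "periodic_swap N a b x = x"
    if *: "\<And>e k. symm e k \<Longrightarrow> x \<noteq> e * a + k \<and> x \<noteq> e * b + k" for x
  proof -
    have "\<not> N dvd (x - a)" using *[of 1 "x - a"] by (auto simp: symmetry_def)
    moreover have "\<not> N dvd (x - b)" using *[of 1 "x - b"] by (auto simp: symmetry_def)
    ultimately show ?thesis by (simp add: periodic_swap_def cong_iff_dvd_diff)
  qed
  ultimately show ?thesis
    using ab unfolding swaps_def by (simp add: periodic_swap_def cong_iff_dvd_diff)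
qed

text \<open>Since \<open>N\<close> divides \<open>a + b\<close>, a reflection exchanges
  \<open>a\<close> and \<open>b\<close>; the pair is its own mirror image and one periodic swap is
  already equivariant.\<close>

lemma swaps_periodic_swap_symmetric:
  assumes self: "N dvd (a + b)" and ab: "\<not> N dvd (b - a)"
  shows "swaps (periodic_swap N a b) a b"
proof -
  have "equivariant (periodic_swap N a b)"
    unfolding equivariant_def
  proof (intro allI impI)
    fix e k x assume s: "symm e k"
    have k: "N dvd k" using s by (auto simp: symmetry_def)
    from s show "periodic_swap N a b (e * x + k) = e * periodic_swap N a b x + k"
    proof (cases rule: sym_cases)
      case 1
      have "N dvd (x + k - c) \<longleftrightarrow> N dvd (x - c)" for c
        using dvd_add_left_iff[OF k, of "x - c"] by (simp add: algebra_simps)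
      then show ?thesis using 1 by (simp add: periodic_swap_def cong_iff_dvd_diff)
    next
      case 2
      have *: "N dvd (k - x - a) \<longleftrightarrow> N dvd (x - b)"
        using dvd_diff_right_iff[of N "k - (a + b)" "x - b"] k self by (simp add: algebra_simps)
      have "N dvd (k - x - b) \<longleftrightarrow> N dvd (x - a)"
        using dvd_diff_right_iff[of N "k - (a + b)" "x - a"] k self by (simp add: algebra_simps)
      moreover have "\<not> (N dvd (x - a) \<and> N dvd (x - b))"
        using ab dvd_diff[of N "x - a" "x - b"] by auto
      ultimately show ?thesis using 2 * by (auto simp: periodic_swap_def cong_iff_dvd_diff)
    qed
  qed
  moreover have "periodic_swap N a b x = x"
    if *: "\<And>e k. symm e k \<Longrightarrow> x \<noteq> e * a + k \<and> x \<noteq> e * b + k" for x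
  proof -
    have "\<not> N dvd (x - a)" using *[of 1 "x - a"] by (auto simp: symmetry_def)
    moreover have "\<not> N dvd (x - b)" using *[of 1 "x - b"] by (auto simp: symmetry_def)
    ultimately show ?thesis by (simp add: periodic_swap_def cong_iff_dvd_diff)
  qed
  ultimately show ?thesis
    using ab unfolding swaps_def by (simp add: periodic_swap_def cong_iff_dvd_diff)
qed

text \<open>The mirror pair has to be swapped too. The divisibility conditions make the classes of
  \<open>a\<close>, \<open>b\<close>, \<open>-a\<close>, \<open>-b\<close> distinct, so the two
  factors do not interfere.\<close>

lemma swaps_periodic_swap_comp:
  assumes R and ab: "\<not> N dvd (b - a)" "\<not> N dvd (a + b)" "\<not> N dvd 2 * a" "\<not> N dvd 2 * b"
  shows "swaps (periodic_swap N a b \<circ> periodic_swap N (- a) (- b)) a b"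
proof -
  define t where "t = periodic_swap N a b \<circ> periodic_swap N (- a) (- b)"
  have excl: "\<not> (N dvd (x - a) \<and> N dvd (x - b))" "\<not> (N dvd (x + a) \<and> N dvd (x + b))"
      "\<not> (N dvd (x - a) \<and> N dvd (x + a))" "\<not> (N dvd (x - b) \<and> N dvd (x + b))"
      "\<not> (N dvd (x - a) \<and> N dvd (x + b))" "\<not> (N dvd (x + a) \<and> N dvd (x - b))" for x
    using ab dvd_diff[of N "x - a" "x - b"] dvd_diff[of N "x + b" "x + a"]
      dvd_diff[of N "x + a" "x - a"] dvd_diff[of N "x + b" "x - b"]
      dvd_diff[of N "x + b" "x - a"] dvd_diff[of N "x + a" "x - b"]
    by (auto simp: add.commute)
  have t: "t x = (if N dvd (x - a) \<or> N dvd (x + b) then x + (b - a)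
      else if N dvd (x - b) \<or> N dvd (x + a) then x + (a - b) else x)" for x
  proof -
    \<comment> \<open>A point moved by the inner swap must not be moved again by the outer one; each
      fact excludes one such collision.\<close>
    have "N dvd (x + (a - b) - b) \<Longrightarrow> N dvd (x + a) \<Longrightarrow> False"
      using ab(4) dvd_diff[of N "x + a" "x + (a - b) - b"] by simp
    moreover have "N dvd (x + (a - b) - a) \<Longrightarrow> N dvd (x + a) \<Longrightarrow> False"
      using ab(2) dvd_diff[of N "x + a" "x + (a - b) - a"] by (simp add: add.commute)
    moreover have "N dvd (x + (b - a) - b) \<Longrightarrow> N dvd (x + b) \<Longrightarrow> False"
      using ab(2) dvd_diff[of N "x + b" "x + (b - a) - b"] by (simp add: add.commute)
    moreover have "N dvd (x + (b - a) - a) \<Longrightarrow> N dvd (x + b) \<Longrightarrow> False"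
      using ab(3) dvd_diff[of N "x + b" "x + (b - a) - a"] by simp
    ultimately show ?thesis
      using excl[of x] unfolding t_def periodic_swap_def cong_iff_dvd_diff
      by (auto simp: algebra_simps)
  qed
  have "equivariant t"
    unfolding equivariant_def
  proof (intro allI impI)
    fix e k x assume s: "symm e k"
    have k: "N dvd k" using s by (auto simp: symmetry_def)
    from s show "t (e * x + k) = e * t x + k"
    proof (cases rule: sym_cases)
      case 1
      have "N dvd (x + k - c) \<longleftrightarrow> N dvd (x - c)" "N dvd (x + k + c) \<longleftrightarrow> N dvd (x + c)" for c
        using dvd_add_left_iff[OF k, of "x - c"] dvd_add_left_iff[OF k, of "x + c"]
        by (simp_all add: algebra_simps)
      then show ?thesis using 1 by (simp add: t)
    next
      case 2
      have "N dvd (k - x - c) \<longleftrightarrow> N dvd (x + c)" "N dvd (k - x + c) \<longleftrightarrow> N dvd (x - c)" for c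
        using dvd_diff_right_iff[OF k, of "x + c"] dvd_diff_right_iff[OF k, of "x - c"]
        by (simp_all add: algebra_simps)
      then show ?thesis using 2 excl[of x] by (auto simp: t)
    qed
  qed
  moreover have "t x = x"
    if *: "\<And>e k. symm e k \<Longrightarrow> x \<noteq> e * a + k \<and> x \<noteq> e * b + k" for x
  proof -
    have "\<not> N dvd (x - a)" "\<not> N dvd (x - b)" "\<not> N dvd (x + a)" "\<not> N dvd (x + b)"
      using *[of 1 "x - a"] *[of 1 "x - b"] *[of "- 1" "x + a"] *[of "- 1" "x + b"] \<open>R\<close>
      by (auto simp: symmetry_def)
    then show ?thesis by (simp add: t)
  qed
  moreover have "t a = b" "t b = a" using ab by (simp_all add: t add.commute)
  ultimately show ?thesis
    unfolding swaps_def t_def by blast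
qed

end

lemma transpose_eq_periodic_swap: "Transposition.transpose a b = periodic_swap 0 a b"
  by (auto simp: fun_eq_iff periodic_swap_def cong_iff_dvd_diff transpose_def)

text \<open>For \<open>AffC\<close> this is the translation obtained by composing the reflections
  about 0 and n+1.\<close>

fun period :: "family \<Rightarrow> nat \<Rightarrow> int" where
  "period SymA n = 0"
| "period SymB n = 0"
| "period AffA n = int n"
| "period AffC n = 2 * (int n + 1)"

definition reflected :: "family \<Rightarrow> bool" where
  "reflected W \<longleftrightarrow> W = SymB \<or> W = AffC"

text \<open>The generator \<open>i\<close> swaps the positions \<open>left W i\<close> and \<open>right W n i\<close> and their images.\<close>

definition left :: "family \<Rightarrow> nat \<Rightarrow> int" where
  "left W i = (if reflected W \<and> i = 0 then - 1 else int i)"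

definition right :: "family \<Rightarrow> nat \<Rightarrow> nat \<Rightarrow> int" where
  "right W n i = (if reflected W \<and> i = 0 then 1 else if W = AffC \<and> i = n then int n + 2 else int i + 1)"

locale coxeter_family =
  fixes W :: family and n :: nat
  assumes admissible: "admissible W n"

sublocale coxeter_family \<subseteq> orbits "period W n" "reflected W" "unfrozen W n"
proof
  fix e k x
  assume s: "symmetry (period W n) (reflected W) e k" and x: "x \<in> unfrozen W n"
  show "e * x + k \<in> unfrozen W n"
  proof (cases W)
    case AffC
    then have "2 * (int n + 1) dvd k" using s by (auto simp: symmetry_def)
    then have k: "int n + 1 dvd k" by (rule dvd_mult_right)
    have "int n + 1 dvd e * x + k \<longleftrightarrow> int n + 1 dvd x"
      using dvd_add_left_iff[OF k, of "e * x"] s by (auto simp: symmetry_def)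
    then show ?thesis using x AffC by simp
  qed (use s x in \<open>auto simp: symmetry_def reflected_def\<close>)
next
  fix k x
  assume s: "symmetry (period W n) (reflected W) (- 1) k" and x: "x \<in> unfrozen W n"
  show "2 * x \<noteq> k"
  proof (cases W)
    case AffC
    then have "2 * (int n + 1) dvd k" "\<not> 2 * (int n + 1) dvd 2 * x"
      using s x by (auto simp: symmetry_def simp del: distrib_left_numeral)
    then show ?thesis by blast
  qed (use s x in \<open>auto simp: symmetry_def reflected_def\<close>)
qed

context coxeter_family begin

lemma adjacent_letter:
  assumes "i \<in> alphabet W n"
  shows "adjacent (left W i) (right W n i)"
proof (cases W)
  case AffC
  have n: "n \<ge> 1" and i: "i \<le> n" using admissible AffC assms by auto
  have nd: "\<not> int n + 1 dvd x" if "0 < x" "x < int n + 1" for x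
    using zdvd_not_zless that by blast
  have nd2: "\<not> int n + 1 dvd x" if "- (int n + 1) < x" "x < 0" for x
    using nd[of "- x"] that by simp
  have nd3: "\<not> int n + 1 dvd x" if "int n + 1 < x" "x < 2 * (int n + 1)" for x
    using nd[of "x - (int n + 1)"] that by (simp add: dvd_diff_left_iff)
  consider "i = 0" | "i = n" "i \<noteq> 0" | "0 < i" "i < n" using i by linarith
  then show ?thesis
  proof cases
    case 1
    have "\<not> (- 1 < x \<and> x < 1)" if "\<not> int n + 1 dvd x" for x
      using that by (cases "x = 0") auto
    then show ?thesis using 1 AffC n nd[of 1]
      unfolding adjacent_def by (auto simp: left_def right_def reflected_def)
  next
    case 2
    have "\<not> (int n < x \<and> x < int n + 2)" if "\<not> int n + 1 dvd x" for x
      using that by (cases "x = int n + 1") auto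
    then show ?thesis using 2 AffC n nd[of "int n"] nd3[of "int n + 2"]
      unfolding adjacent_def by (auto simp: left_def right_def reflected_def)
  next
    case 3
    then show ?thesis using AffC nd[of "int i"] nd[of "int i + 1"]
      unfolding adjacent_def by (auto simp: left_def right_def reflected_def)
  qed
qed (unfold adjacent_def, use admissible assms in \<open>auto simp: left_def right_def reflected_def\<close>)

lemma swaps_generator:
  assumes "i \<in> alphabet W n"
  shows "swaps (generator W n i) (left W i) (right W n i)"
proof (cases W)
  case SymA
  then show ?thesis
    using swaps_periodic_swap[of "right W n i" "left W i"] by (simp add: left_def right_def reflected_def transpose_eq_periodic_swap)
next
  case SymB
  then show ?thesis
    using swaps_periodic_swap_symmetric[of "left W i" "right W n i"] 
      swaps_periodic_swap_comp[of "right W n i" "left W i"]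
    by (auto simp: left_def right_def reflected_def transpose_eq_periodic_swap)
next
  case AffA
  then have "\<not> int n dvd 1" using admissible zdvd_not_zless[of 1 "int n"] by simp
  then show ?thesis
    using AffA swaps_periodic_swap[of "right W n i" "left W i"] by (simp add: left_def right_def reflected_def)
next
  case AffC
  have n: "n \<ge> 1" and i: "i \<le> n" using admissible AffC assms by auto
  have nd: "\<not> 2 * (int n + 1) dvd x" if "0 < x" "x < 2 * (int n + 1)" for x
    using zdvd_not_zless that by blast
  consider "i = 0" | "i = n" "i \<noteq> 0" | "0 < i" "i < n" using i by linarith
  then show ?thesis
  proof cases
    case 1
    then show ?thesis using AffC n nd[of 2] swaps_periodic_swap_symmetric[of "left W i" "right W n i"]
      by (simp add: left_def right_def reflected_def)
  next
    case 2
    have "2 * (int n + 1) dvd int n + (int n + 2)" by simp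
    with 2 show ?thesis using AffC n nd[of 2] swaps_periodic_swap_symmetric[of "left W i" "right W n i"]
      by (simp add: left_def right_def reflected_def)
  next
    case 3
    have "swaps (periodic_swap (period W n) (int i) (int i + 1) \<circ>
       periodic_swap (period W n) (- int i) (- (int i + 1))) (int i) (int i + 1)"
      by (rule swaps_periodic_swap_comp)
        (use AffC 3 nd[of 1] nd[of "2 * int i + 1"] nd[of "2 * int i"] nd[of "2 * (int i + 1)"]
          in \<open>simp_all add: reflected_def\<close>)
    then show ?thesis using AffC 3 by (simp add: left_def right_def reflected_def)
  qed
qed

end

section \<open>Elements\<close>

lemma shift_multiple:
  fixes w :: "int \<Rightarrow> int"
  assumes "\<And>x. w (x + N) = w x + N"
  shows "w (x + N * j) = w x + N * j"
proof (induction j rule: int_induct[where k = 0])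
  case base
  then show ?case by simp
next
  case (step1 j)
  then show ?case using assms[of "x + N * j"] by (simp add: algebra_simps)
next
  case (step2 j)
  then show ?case using assms[of "x + N * (j - 1)"] by (simp add: algebra_simps)
qed

lemma sum_periodic:
  fixes h :: "int \<Rightarrow> int"
  assumes "\<And>x. h (x + N) = h x" "N > 0"
  shows "sum h {a..<a + N} = sum h {b..<b + N}"
proof -
  have step: "sum h {c + 1..<c + 1 + N} = sum h {c..<c + N}" for c
  proof -
    have "{c..<c + N} = insert c {c + 1..<c + N}" "{c + 1..<c + 1 + N} = insert (c + N) {c + 1..<c + N}"
      using assms(2) by auto
    then show ?thesis using assms(1) by simp
  qed
  have "sum h {a + j..<a + j + N} = sum h {a..<a + N}" for j
  proof (induction j rule: int_induct[where k = 0])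
    case base
    then show ?case by simp
  next
    case (step1 j)
    then show ?case using step[of "a + j"] by (simp add: algebra_simps)
  next
    case (step2 j)
    then show ?case using step[of "a + (j - 1)"] by (simp add: algebra_simps)
  qed
  from this[of "b - a"] show ?thesis by simp
qed

text \<open>Among sets of \<open>N\<close> integers below \<open>a + N\<close> the interval has the
  largest sum: elements of \<open>S\<close> outside it are at most \<open>a - 1\<close> and replace
  as many that are at least \<open>a\<close>.\<close>

lemma int_set_eq_interval:
  fixes S :: "int set"
  assumes "finite S" "\<And>x. x \<in> S \<Longrightarrow> x < a + N" "int (card S) = N" "\<Sum>S = \<Sum>{a..<a + N}"
  shows "S = {a..<a + N}"
proof -
  let ?T = "{a..<a + N}"
  have card: "card S = card ?T" using assms(3) by simp
  have cd: "card (S - ?T) = card (?T - S)"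
    using card assms(1) by (metis add_left_imp_eq card_Int_Diff finite_atLeastLessThan_int inf_commute)
  have "\<Sum>(S - ?T) \<le> (\<Sum>x\<in>S - ?T. a - 1)"
    using assms(2) by (intro sum_mono) force
  moreover have "(\<Sum>x\<in>?T - S. a) \<le> \<Sum>(?T - S)"
    by (intro sum_mono) auto
  moreover have "\<Sum>S = \<Sum>(S \<inter> ?T) + \<Sum>(S - ?T)" "\<Sum>?T = \<Sum>(S \<inter> ?T) + \<Sum>(?T - S)"
    using sum.Int_Diff[OF assms(1), of "\<lambda>x. x" ?T] sum.Int_Diff[of ?T "\<lambda>x. x" S] by (auto simp: Int_commute)
  ultimately have "int (card (?T - S)) * a \<le> int (card (?T - S)) * (a - 1)"
    using assms(4) cd by simp
  then have "card (?T - S) = 0" by (simp add: algebra_simps)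
  moreover have "finite (S - ?T)" "finite (?T - S)" using assms(1) by simp_all
  ultimately have "?T - S = {}" "S - ?T = {}" using cd by (metis card_0_eq)+
  then show ?thesis by blast
qed

text \<open>The last window below \<open>a\<close> is mapped to as many values below
  \<open>a\<close> with the same sum, hence onto itself. Its translates fill the ray, so no value
  below \<open>a\<close> is left for a position from above. The shift by -1 shows the role of the
  window sums.\<close>

lemma periodic_below_imp_above:
  fixes w :: "int \<Rightarrow> int"
  assumes "inj w" and shift: "\<And>x. w (x + N) = w x + N" and N: "N > 0"
    and sum: "\<And>a. (\<Sum>x\<in>{a..<a + N}. w x - x) = 0"
    and below: "\<And>x. x < a \<Longrightarrow> w x < a" and "x \<ge> a"
  shows "w x \<ge> a"
proof (rule ccontr)
  assume "\<not> w x \<ge> a"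
  define T where "T = {a - N..<a - N + N}"
  have inj: "inj_on w T" using assms(1) by (rule inj_on_subset) simp
  have "w ` T = T"
    unfolding T_def
  proof (rule int_set_eq_interval)
    show "int (card (w ` {a - N..<a - N + N})) = N"
      using card_image[OF inj] N by (simp add: T_def)
    have "sum w T = \<Sum>T" using sum[of "a - N"] by (simp add: T_def sum_subtractf)
    then show "\<Sum>(w ` {a - N..<a - N + N}) = \<Sum>{a - N..<a - N + N}"
      using sum.reindex[OF inj, of "\<lambda>x. x"] by (simp add: T_def)
  qed (use below in auto)
  \<comment> \<open>The multiple of \<open>N\<close> that brings \<open>w x\<close> into the window
    from \<open>a - N\<close> to \<open>a - 1\<close>.\<close>
  define j where "j = (a - 1 - w x) div N"
  have "j \<ge> 0" using \<open>\<not> w x \<ge> a\<close> N by (simp add: j_def pos_imp_zdiv_nonneg_iff)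
  have "N * j + (a - 1 - w x) mod N = a - 1 - w x" by (simp add: j_def)
  then have "w x + N * j \<in> T"
    using pos_mod_bound[OF N, of "a - 1 - w x"] pos_mod_sign[OF N, of "a - 1 - w x"]
    unfolding T_def by simp
  then have "w (x + N * j) \<in> w ` T" using \<open>w ` T = T\<close> shift_multiple[of w, OF shift] by simp
  then have "x + N * j \<in> T" using assms(1) by (simp add: inj_image_mem_iff)
  then have "x + N * j < a" by (simp add: T_def)
  moreover have "N * j \<ge> 0" using N \<open>j \<ge> 0\<close> by simp
  ultimately show False using \<open>x \<ge> a\<close> by simp
qed

lemma periodic_above_imp_below:
  fixes w :: "int \<Rightarrow> int"
  assumes "inj w" and shift: "\<And>x. w (x + N) = w x + N" and N: "N > 0"
    and sum: "\<And>a. (\<Sum>x\<in>{a..<a + N}. w x - x) = 0"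
    and above: "\<And>x. x \<ge> a \<Longrightarrow> w x \<ge> a" and "x < a"
  shows "w x < a"
proof -
  \<comment> \<open>Conjugation by negation reduces this to \<open>periodic_below_imp_above\<close>;
    the positions below \<open>a\<close> become those from \<open>- a + 1\<close> on.\<close>
  define v where "v = (\<lambda>x. - w (- x))"
  have "v (- x) \<ge> - a + 1"
  proof (rule periodic_below_imp_above[of v N])
    show "inj v"
    proof (rule injI)
      fix x y assume "v x = v y"
      then have "w (- x) = w (- y)" by (simp add: v_def)
      from injD[OF assms(1) this] show "x = y" by simp
    qed
    show "v (x + N) = v x + N" for x using shift[of "- x - N"] by (simp add: v_def)
    show "(\<Sum>x = c..<c + N. v x - x) = 0" for c
    proof -
      have "(\<Sum>x = c..<c + N. v x - x) = (\<Sum>x \<in> {- c - N + 1..<(- c - N + 1) + N}. - (w x - x))"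
        by (rule sum.reindex_bij_witness[of _ uminus uminus]) (auto simp: v_def)
      also have "\<dots> = 0" using sum[of "- c - N + 1"] unfolding sum_negf by simp
      finally show ?thesis .
    qed
    show "v x < - a + 1" if "x < - a + 1" for x using above[of "- x"] that by (simp add: v_def)
  qed (use assms in auto)
  then show ?thesis by (simp add: v_def)
qed

text \<open>An injective self-map of the finite set \<open>F \<inter> A\<close> is onto, so values
  in \<open>A\<close> come from \<open>A\<close>.\<close>

lemma permutes_invariant_set:
  assumes "finite F" "w permutes F" "\<And>x. x \<in> A \<Longrightarrow> w x \<in> A" "w x \<in> A"
  shows "x \<in> A"
proof (cases "x \<in> F")
  case True
  have inj: "inj w" by (rule permutes_inj[OF assms(2)])
  have "w ` (F \<inter> A) = F \<inter> A"
    by (rule endo_inj_surj)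
      (use assms inj permutes_in_image[OF assms(2)] in \<open>auto intro: inj_on_subset\<close>)
  then have "w x \<in> w ` (F \<inter> A)" using assms(4) True permutes_in_image[OF assms(2)] by auto
  then show ?thesis using inj by (simp add: inj_image_mem_iff)
next
  case False
  then show ?thesis using assms by (metis permutes_not_in)
qed

context orbits begin

lemma equivariantI:
  assumes shift: "\<And>x. w (x + N) = w x + N" and odd: "\<And>x. R \<Longrightarrow> w (- x) = - w x"
  shows "equivariant w"
  unfolding equivariant_def
proof (intro allI impI)
  fix e k x assume s: "symm e k"
  then obtain j where j: "k = N * j" by (auto simp: symmetry_def)
  have "w (e * x + k) = w (e * x) + k"
    using shift_multiple[of w, OF shift] j by simp
  also have "w (e * x) = e * w x" using s odd by (auto simp: symmetry_def)
  finally show "w (e * x + k) = e * w x + k" .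
qed

lemma compatible_comp: "compatible v \<Longrightarrow> compatible w \<Longrightarrow> compatible (v \<circ> w)"
  by (simp add: compatible_def equivariant_comp bij_comp)

lemma compatible_id: "compatible id"
  by (simp add: compatible_def equivariant_id)

end

context coxeter_family begin

text \<open>The uniform description used from here on; only the normalisation of \<open>AffA\<close>
  is specific to a family.\<close>

lemma elements_iff:
  "w \<in> elements W n \<longleftrightarrow> compatible w \<and> (\<forall>x. x \<notin> unfrozen W n \<longrightarrow> w x = x) \<and>
     (W = AffA \<longrightarrow> (\<Sum>i = 1..int n. w i) = int ((n + 1) choose 2))" (is "_ \<longleftrightarrow> ?R")
proof
  assume w: "w \<in> elements W n"
  show ?R
  proof (cases W)
    case SymA
    have p: "w permutes {1..int n}" using w SymA by simp
    have "equivariant w" by (rule equivariantI) (auto simp: SymA reflected_def)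
    then show ?thesis
      unfolding compatible_def using p SymA permutes_in_image[OF p] permutes_not_in[OF p]
      by (auto simp: permutes_bij)
  next
    case SymB
    have p: "w permutes {- int n..int n}" and odd: "w (- x) = - w x" for x using w SymB by auto
    have w0: "w 0 = 0" using odd[of 0] by simp
    have "equivariant w" by (rule equivariantI) (auto simp: SymB odd)
    then show ?thesis
      unfolding compatible_def using p SymB permutes_in_image[OF p] permutes_not_in[OF p] w0
      by (auto simp: permutes_bij) (metis permutes_inj[OF p] injD)+
  next
    case AffA
    have "equivariant w" by (rule equivariantI) (use w in \<open>auto simp: AffA reflected_def\<close>)
    then show ?thesis
      unfolding compatible_def using w AffA by auto
  next
    case AffC
    have odd: "w (- x) = - w x" and r: "w (2 * (int n + 1) - x) = 2 * (int n + 1) - w x"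
      and bij: "bij w" for x using w AffC by auto
    have shift: "w (x + 2 * (int n + 1)) = w x + 2 * (int n + 1)" for x
      using r[of "- x"] odd[of x] by (simp add: algebra_simps)
    have e: "equivariant w" by (rule equivariantI) (use shift odd in \<open>auto simp: AffC\<close>)
    have frozen: "w x = x" if "int n + 1 dvd x" for x
    proof -
      obtain j where j: "x = (int n + 1) * j" using \<open>int n + 1 dvd x\<close> by auto
      have "w 0 = 0" "w (int n + 1) = int n + 1" using odd[of 0] r[of "int n + 1"] by auto
      \<comment> \<open>Even multiples of n+1 are translates of the fixed point 0, odd ones of the
        fixed point n+1.\<close>
      moreover obtain c where "j = 2 * c \<or> j = 2 * c + 1" by (meson evenE oddE)
      then have "x = 0 + 2 * (int n + 1) * c \<or> x = (int n + 1) + 2 * (int n + 1) * c"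
        using j by (auto simp: algebra_simps)
      ultimately show ?thesis using shift_multiple[of w, OF shift] by metis
    qed
    moreover have "\<not> int n + 1 dvd w x" if "\<not> int n + 1 dvd x" for x
      using that frozen[of "w x"] bij by (metis bij_is_inj injD)
    ultimately show ?thesis
      unfolding compatible_def using e bij AffC by auto
  qed
next
  assume R: ?R
  then have e: "equivariant w" and bij: "bij w" and U: "\<And>x. x \<in> unfrozen W n \<Longrightarrow> w x \<in> unfrozen W n"
    and fixed: "\<And>x. x \<notin> unfrozen W n \<Longrightarrow> w x = x" by (auto simp: compatible_def)
  have odd: "w (- x) = - w x" if "reflected W" for x
    using equivariant_reflection[OF e, of 0] that by (simp add: symmetry_def)
  show "w \<in> elements W n"
  proof (cases W)
    case SymA
    then show ?thesis using fixed bij by (auto simp: permutes_def bij_iff)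
  next
    case SymB
    then show ?thesis using fixed bij odd by (auto simp: permutes_def bij_iff reflected_def)
  next
    case AffA
    then show ?thesis using equivariant_translation[OF e, of "int n"] R bij
      by (auto simp: symmetry_def)
  next
    case AffC
    then show ?thesis using equivariant_reflection[OF e, of "2 * (int n + 1)"] odd bij
      by (auto simp: symmetry_def reflected_def)
  qed
qed

lemma elements_compatible: "w \<in> elements W n \<Longrightarrow> compatible w"
  by (simp add: elements_iff)

lemma elements_fixes: "w \<in> elements W n \<Longrightarrow> x \<notin> unfrozen W n \<Longrightarrow> w x = x"
  by (simp add: elements_iff)

end

section \<open>Displacements and balance\<close>

text \<open>Kept general in \<open>F\<close>: \<open>abs\<close> gives the disarray, squares give a
  measure that drops at every descent, and the identity shows that window sums are
  preserved.\<close>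

definition displacement :: "nat \<Rightarrow> (int \<Rightarrow> int) \<Rightarrow> (int \<Rightarrow> int) \<Rightarrow> int" where
  "displacement n F w = (\<Sum>i = 1..int n. F (w i - i))"

lemma sum_swap_two:
  fixes w s F :: "int \<Rightarrow> int"
  assumes "finite A" "l \<in> A" "r \<in> A" "l \<noteq> r" "s l = r" "s r = l"
    and "\<And>x. x \<in> A \<Longrightarrow> x \<noteq> l \<Longrightarrow> x \<noteq> r \<Longrightarrow> s x = x"
  shows "(\<Sum>x\<in>A. F ((w \<circ> s) x - x)) - (\<Sum>x\<in>A. F (w x - x)) =
    F (w r - l) + F (w l - r) - F (w l - l) - F (w r - r)"
proof -
  have A: "A = insert l (insert r (A - {l, r}))" using assms by blast
  have "(\<Sum>x\<in>A - {l, r}. F ((w \<circ> s) x - x)) = (\<Sum>x\<in>A - {l, r}. F (w x - x))"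
    by (rule sum.cong) (use assms in auto)
  then show ?thesis
    using assms by (subst (1 2) A) (simp add: sum.insert_if)
qed

lemma sum_move_one:
  fixes w s F :: "int \<Rightarrow> int"
  assumes "finite A" "l \<in> A" and "\<And>x. x \<in> A \<Longrightarrow> x \<noteq> l \<Longrightarrow> s x = x"
  shows "(\<Sum>x\<in>A. F ((w \<circ> s) x - x)) - (\<Sum>x\<in>A. F (w x - x)) = F (w (s l) - l) - F (w l - l)"
proof -
  have eq: "(\<Sum>x\<in>A - {l}. F ((w \<circ> s) x - x)) = (\<Sum>x\<in>A - {l}. F (w x - x))"
    by (rule sum.cong) (use assms in auto)
  show ?thesis
    unfolding sum.remove[OF assms(1,2), of "\<lambda>x. F ((w \<circ> s) x - x)"]
      sum.remove[OF assms(1,2), of "\<lambda>x. F (w x - x)"] eq by simp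
qed

context orbits begin

lemma swaps_moved_congruent:
  assumes "swaps t a b" "t x \<noteq> x"
  obtains "N dvd x - a" | "N dvd x - b" | "R" "N dvd x + a" | "R" "N dvd x + b"
proof -
  from swaps_moved[OF assms] consider
      k where "symm 1 k" "x = a + k" | k where "symm 1 k" "x = b + k"
    | k where "symm (- 1) k" "x = k - b" | k where "symm (- 1) k" "x = k - a"
    unfolding pair_image_def by blast
  then show thesis
  proof cases
    case (1 k)
    show ?thesis by (rule that(1)) (use 1 in \<open>simp add: symmetry_def\<close>)
  next
    case (2 k)
    show ?thesis by (rule that(2)) (use 2 in \<open>simp add: symmetry_def\<close>)
  next
    case (3 k)
    show ?thesis by (rule that(4)) (use 3 in \<open>simp_all add: symmetry_def\<close>)
  next
    case (4 k)
    show ?thesis by (rule that(3)) (use 4 in \<open>simp_all add: symmetry_def\<close>)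
  qed
qed

end

lemma dvd_small_int: "N dvd d \<Longrightarrow> - N < d \<Longrightarrow> d < N \<Longrightarrow> d = 0" for N d :: int
  using dvd_imp_le_int[of d N] by (cases "d = 0") auto

context coxeter_family begin

text \<open>The other images of the swapped pair lie outside the window. This fails in
  \<open>AffA\<close>, where the letter 0 also moves n.\<close>

lemma generator_fixes_window:
  assumes i: "i \<in> alphabet W n" and "W \<noteq> AffA" "x \<in> {1..int n}" "x \<noteq> left W i" "x \<noteq> right W n i"
  shows "generator W n i x = x"
proof (rule ccontr)
  assume moved: "generator W n i x \<noteq> x"
  show False
  proof (cases W)
    case AffC
    have "int i \<le> int n" "n \<ge> 1" using i AffC admissible by auto
    have zero: "d = 0" if "2 * (int n + 1) dvd d" "- (2 * (int n + 1)) < d" "d < 2 * (int n + 1)" for d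
      using dvd_small_int[OF that] .
    \<comment> \<open>The sum of \<open>x\<close> and the right position reaches the period only for
      \<open>x = n\<close> and n+2, and then \<open>x\<close> is the left position.\<close>
    have full: "d = 2 * (int n + 1)" if "2 * (int n + 1) dvd d" "0 < d" "d \<le> 2 * (int n + 1)" for d
      using that zdvd_imp_le[of "2 * (int n + 1)" d] by linarith
    from swaps_moved_congruent[OF swaps_generator[OF i] moved] show ?thesis
    proof cases
      case 1
      then show ?thesis using zero[of "x - left W i"] assms AffC \<open>int i \<le> int n\<close>
        by (auto simp: left_def split: if_splits)
    next
      case 2
      then show ?thesis using zero[of "x - right W n i"] assms AffC \<open>int i \<le> int n\<close>
        by (auto simp: right_def split: if_splits)
    next
      case 3
      then show ?thesis using zero[of "x + left W i"] assms AffC \<open>int i \<le> int n\<close>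
        by (auto simp: left_def right_def reflected_def split: if_splits)
    next
      case 4
      then show ?thesis using full[of "x + right W n i"] assms AffC \<open>int i \<le> int n\<close>
        by (auto simp: left_def right_def reflected_def split: if_splits)
    qed
  next
    case AffA
    then show ?thesis using assms by simp
  next
    case SymA
    then show ?thesis using swaps_moved_congruent[OF swaps_generator[OF i] moved] assms
      by (auto simp: reflected_def)
  next
    case SymB
    then show ?thesis using swaps_moved_congruent[OF swaps_generator[OF i] moved] assms
      by (auto simp: left_def right_def reflected_def split: if_splits)
  qed
qed

text \<open>By periodicity the window may start at \<open>i\<close>; it then contains both swapped
  positions, also for the letter 0.\<close>

lemma AffA_window:
  assumes "W = AffA" and w: "compatible w" and i: "i \<in> alphabet W n"
  shows "displacement n F (w \<circ> generator W n i) - displacement n F w =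
    F (w (right W n i) - left W i) + F (w (left W i) - right W n i)
      - F (w (left W i) - left W i) - F (w (right W n i) - right W n i)"
proof -
  let ?A = "{int i..<int i + int n}"
  have n: "n \<ge> 2" and lr: "left W i = int i" "right W n i = int i + 1"
    using admissible assms(1) by (auto simp: left_def right_def reflected_def)
  have s: "swaps (generator W n i) (int i) (int i + 1)" using swaps_generator[OF i] lr by simp
  have fixed: "generator W n i x = x" if "x \<in> ?A" "x \<noteq> int i" "x \<noteq> int i + 1" for x
  proof (rule ccontr)
    assume moved: "generator W n i x \<noteq> x"
    have "int n dvd x - int i \<or> int n dvd x - (int i + 1)"
      using swaps_moved_congruent[OF s moved] assms(1) by (auto simp: reflected_def)
    then show False
      using dvd_small_int[of "int n" "x - int i"] dvd_small_int[of "int n" "x - (int i + 1)"] that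
      by auto
  qed
  have window: "displacement n F v = (\<Sum>x\<in>?A. F (v x - x))" if "compatible v" for v
  proof -
    have "symm 1 (int n)" using assms(1) by (simp add: symmetry_def)
    then have "v (x + int n) = v x + int n" for x
      using equivariant_translation that unfolding compatible_def by blast
    then have "(\<Sum>x\<in>{1..<1 + int n}. F (v x - x)) = (\<Sum>x\<in>?A. F (v x - x))"
      using n by (intro sum_periodic) auto
    moreover have "{1..<1 + int n} = {1..int n}" by auto
    ultimately show ?thesis by (simp add: displacement_def)
  qed
  have c: "compatible (w \<circ> generator W n i)"
    using compatible_comp[OF w swaps_compatible[OF swaps_generator[OF i] adjacent_letter[OF i]]] .
  show ?thesis
    unfolding window[OF w] window[OF c] lr
    by (rule sum_swap_two) (use n s fixed in \<open>auto simp: swaps_def\<close>)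
qed

lemma generator_in_elements:
  assumes w: "w \<in> elements W n" and i: "i \<in> alphabet W n"
  shows "w \<circ> generator W n i \<in> elements W n"
proof -
  note s = swaps_generator[OF i] and a = adjacent_letter[OF i]
  have "(\<Sum>x = 1..int n. (w \<circ> generator W n i) x) = (\<Sum>x = 1..int n. w x)" if "W = AffA"
    using AffA_window[OF that elements_compatible[OF w] i, of id]
    by (simp add: displacement_def sum_subtractf)
  moreover have "generator W n i x = x" if "x \<notin> unfrozen W n" for x
    by (rule swaps_moved_adjacent[OF s a, of x]) (use that in \<open>auto simp: adjacent_def\<close>)
  ultimately show ?thesis
    using w compatible_comp[OF _ swaps_compatible[OF s a]] unfolding elements_iff by auto
qed

lemma id_in_elements: "id \<in> elements W n"
proof -
  have "(\<Sum>i = 1..int n. i) = int ((n + 1) choose 2)"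
  proof -
    have "(\<Sum>i = 1..int n. i) = int (\<Sum>i = 1..n. i)"
      unfolding of_nat_sum by (rule sum.reindex_bij_witness[of _ int nat]) auto
    also have "(\<Sum>i = 1..n. i) = (n + 1) choose 2"
      using gauss_sum_from_Suc_0[of n, where ?'a = nat] by (simp add: choose_two)
    finally show ?thesis .
  qed
  then show ?thesis by (simp add: elements_iff compatible_id)
qed

text \<open>
  If \<open>right - left = 2\<close>, the two positions are exchanged by a reflection and only one of them lies in
  the window; the factor \<open>right - left\<close> accounts for the other one.
\<close>

lemma displacement_generator:
  assumes w: "w \<in> elements W n" and i: "i \<in> alphabet W n" and even: "\<And>d. F (- d) = F d"
  shows "(right W n i - left W i) * (displacement n F (w \<circ> generator W n i) - displacement n F w) =
    F (w (right W n i) - left W i) + F (w (left W i) - right W n i)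
      - F (w (left W i) - left W i) - F (w (right W n i) - right W n i)"
proof -
  have s: "swaps (generator W n i) (left W i) (right W n i)" by (rule swaps_generator[OF i])
  have e: "equivariant w" using elements_compatible[OF w] by (simp add: compatible_def)
  consider "W = AffA" | "reflected W" "i = 0" | "W = AffC" "i = n" "i \<noteq> 0"
    | "W \<noteq> AffA" "left W i = int i" "right W n i = int i + 1" "1 \<le> i" "i < n"
  proof -
    have "1 \<le> i \<and> i < n" if "W \<noteq> AffA" "\<not> (reflected W \<and> i = 0)" "\<not> (W = AffC \<and> i = n)"
      using i that by (cases W) (auto simp: reflected_def)
    then show ?thesis using that by (auto simp: left_def right_def reflected_def)
  qed
  then show ?thesis
  proof cases
    case 1
    then show ?thesis
      using AffA_window[OF 1 elements_compatible[OF w] i, of F]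
      by (simp add: left_def right_def reflected_def)
  next
    case 2
    then have lr: "left W i = - 1" "right W n i = 1" and W: "W \<noteq> AffA" and n: "n \<ge> 1"
      using admissible by (auto simp: left_def right_def reflected_def)
    have odd: "w (- 1) = - w 1"
      using equivariant_reflection[OF e, of 0 1] 2(1) by (simp add: symmetry_def)
    have "displacement n F (w \<circ> generator W n i) - displacement n F w =
        F (w (generator W n i 1) - 1) - F (w 1 - 1)"
      unfolding displacement_def
      by (rule sum_move_one) (use generator_fixes_window[OF i W] lr n in auto)
    moreover have "generator W n i 1 = - 1" using s lr by (simp add: swaps_def)
    ultimately show ?thesis
      using lr odd even[of "w 1 + 1"] even[of "w 1 - 1"] by simp
  next
    case 3
    then have lr: "left W i = int n" "right W n i = int n + 2" and n: "n \<ge> 1"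
      using admissible by (auto simp: left_def right_def reflected_def)
    have refl: "w (int n + 2) = 2 * int n + 2 - w (int n)"
      using equivariant_reflection[OF e, of "2 * (int n + 1)" "int n"] 3(1)
      by (simp add: symmetry_def reflected_def)
    have "displacement n F (w \<circ> generator W n i) - displacement n F w =
        F (w (generator W n i (int n)) - int n) - F (w (int n) - int n)"
      unfolding displacement_def
      by (rule sum_move_one) (use generator_fixes_window[OF i] 3 lr n in auto)
    moreover have "w (generator W n i (int n)) - int n = w (int n + 2) - int n"
      using s lr by (simp add: swaps_def)
    moreover have "w (int n + 2) - int n = - (w (int n) - (int n + 2))"
      "w (int n + 2) - (int n + 2) = - (w (int n) - int n)"
      using refl by simp_all
    then have F_eq: "F (w (int n + 2) - int n) = F (w (int n) - (int n + 2))"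
      "F (w (int n + 2) - (int n + 2)) = F (w (int n) - int n)"
      by (simp_all only: even)
    ultimately have diff: "displacement n F (w \<circ> generator W n i) - displacement n F w =
        F (w (int n) - (int n + 2)) - F (w (int n) - int n)" by (simp only:)
    show ?thesis
      unfolding lr add_diff_cancel_left' F_eq diff by algebra
  next
    case 4
    have "displacement n F (w \<circ> generator W n i) - displacement n F w =
      F (w (right W n i) - left W i) + F (w (left W i) - right W n i)
      - F (w (left W i) - left W i) - F (w (right W n i) - right W n i)"
      unfolding displacement_def
      by (rule sum_swap_two) (use 4 s generator_fixes_window[OF i 4(1)] in \<open>auto simp: swaps_def\<close>)
    then show ?thesis using 4 by simp
  qed
qed

end

context orbits begin

lemma pair_image_translation: "symm 1 k \<Longrightarrow> x = a + k \<Longrightarrow> y = b + k \<Longrightarrow> pair_image a b x y"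
  unfolding pair_image_def by blast

lemma pair_image_reflection: "symm (- 1) k \<Longrightarrow> x = k - b \<Longrightarrow> y = k - a \<Longrightarrow> pair_image a b x y"
  unfolding pair_image_def by blast

end

section \<open>Adjacent pairs, balance across cuts, and the positions that a letter moves\<close>

context coxeter_family begin

text \<open>The given generators swap all adjacent pairs up to symmetry. This is what allows
  descents to be found at letters.\<close>

lemma adjacent_pair_image:
  assumes ab: "adjacent a b"
  obtains i where "i \<in> alphabet W n" "pair_image (left W i) (right W n i) a b"
proof (cases W)
  case SymA
  have "1 \<le> a" "a < b" "b \<le> int n" and no: "\<And>x. x \<in> unfrozen W n \<Longrightarrow> \<not> (a < x \<and> x < b)"
    using ab SymA unfolding adjacent_def by auto
  have b: "b = a + 1"
    using no[of "a + 1"] SymA \<open>1 \<le> a\<close> \<open>a < b\<close> \<open>b \<le> int n\<close> by auto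
  have "symm 1 0" by (simp add: symmetry_def)
  then show ?thesis
    by (intro that[of "nat a"] pair_image_translation)
      (use SymA b \<open>1 \<le> a\<close> \<open>b \<le> int n\<close> in \<open>auto simp: left_def right_def reflected_def\<close>)
next
  case SymB
  have bounds: "a \<noteq> 0" "b \<noteq> 0" "- int n \<le> a" "a < b" "b \<le> int n"
    and no: "\<And>x. x \<in> unfrozen W n \<Longrightarrow> \<not> (a < x \<and> x < b)"
    using ab SymB unfolding adjacent_def by auto
  have sym: "symm 1 0" "symm (- 1) 0" using SymB by (simp_all add: symmetry_def reflected_def)
  have "b = a + 1 \<or> a = - 1 \<and> b = 1"
    using no[of "a + 1"] no[of 1] SymB bounds by (cases "a = - 1") auto
  then consider "a = - 1" "b = 1" | "a > 0" "b = a + 1" | "a < - 1" "b = a + 1"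
    using bounds by linarith
  then show ?thesis
  proof cases
    case 1
    show ?thesis
      by (rule that[of 0], use 1 SymB bounds in simp, rule pair_image_translation[OF sym(1)])
        (use 1 SymB in \<open>auto simp: left_def right_def reflected_def\<close>)
  next
    case 2
    show ?thesis
      by (rule that[of "nat a"], use 2 SymB bounds in force, rule pair_image_translation[OF sym(1)])
        (use 2 SymB in \<open>auto simp: left_def right_def reflected_def\<close>)
  next
    case 3
    show ?thesis
      by (rule that[of "nat (- b)"], use 3 SymB bounds in force, rule pair_image_reflection[OF sym(2)])
        (use 3 SymB in \<open>auto simp: left_def right_def reflected_def\<close>)
  qed
next
  case AffA
  have n: "n \<ge> 2" using admissible AffA by simp
  have "a < b" and no: "\<And>x. \<not> (a < x \<and> x < b)"
    using ab AffA unfolding adjacent_def by auto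
  have b: "b = a + 1" using no[of "a + 1"] \<open>a < b\<close> by auto
  define r where "r = a mod int n"
  have r: "0 \<le> r" "r < int n" using n by (simp_all add: r_def)
  have k: "symm 1 (a - r)" using AffA by (simp add: symmetry_def r_def)
  show ?thesis
    by (rule that[of "nat r"], use r AffA in force, rule pair_image_translation[OF k])
      (use b r AffA in \<open>auto simp: left_def right_def reflected_def\<close>)
next
  case AffC
  define N where "N = 2 * (int n + 1)"
  have n: "n \<ge> 1" using admissible AffC by simp
  have nd: "\<not> int n + 1 dvd a" "\<not> int n + 1 dvd b" "a < b"
    and no: "\<And>x. \<not> int n + 1 dvd x \<Longrightarrow> \<not> (a < x \<and> x < b)"
    using ab AffC unfolding adjacent_def by auto
  have b: "b = (if int n + 1 dvd a + 1 then a + 2 else a + 1)"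
  proof (cases "int n + 1 dvd a + 1")
    case True
    then have "\<not> int n + 1 dvd a + 2"
      using n zdvd_not_zless[of 1 "int n + 1"] dvd_diff[of "int n + 1" "a + 2" "a + 1"] by auto
    then have "\<not> a + 2 < b" using no[of "a + 2"] by simp
    moreover have "b \<noteq> a + 1" using True nd by metis
    ultimately show ?thesis using True nd by simp
  next
    case False
    then show ?thesis using no[of "a + 1"] nd by simp
  qed
  define r where "r = a mod N"
  have r: "0 \<le> r" "r < N" using n by (simp_all add: r_def N_def)
  have N: "N dvd a - r" by (simp add: r_def)
  then have M: "int n + 1 dvd a - r" unfolding N_def by (rule dvd_mult_right)
  have cong: "int n + 1 dvd r + x \<longleftrightarrow> int n + 1 dvd a + x" for x
    using dvd_add_right_iff[OF M, of "r + x"] by (simp add: algebra_simps)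
  have "N dvd a - r + N" using N by simp
  then have k: "symm 1 (a - r)" "symm (- 1) (a - r + N)" "symm 1 (a - r + N)"
    using N AffC by (simp_all add: symmetry_def reflected_def N_def)
  have "r \<noteq> 0" "r \<noteq> int n + 1" using cong[of 0] nd by auto
  \<comment> \<open>Residues below n+1 are translated to the letter \<open>r\<close>, residue n
    being the pair around n+1. Residue \<open>N - 1\<close> is the pair around a multiple of
    \<open>N\<close>, and the other residues of the upper half are reflected to the letter
    \<open>N - r - 1\<close>.\<close>
  then consider "1 \<le> r" "r < int n" | "r = int n" | "r = N - 1" | "int n + 1 < r" "r < N - 1"
    using r by linarith
  then show ?thesis
  proof cases
    case 1
    then have b: "b = a + 1" using b cong[of 1] zdvd_not_zless[of "r + 1" "int n + 1"] by simp
    show ?thesis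
      by (rule that[of "nat r"], use 1 AffC in force, rule pair_image_translation[OF k(1)])
        (use b 1 AffC in \<open>auto simp: left_def right_def reflected_def\<close>)
  next
    case 2
    then have b: "b = a + 2" using b cong[of 1] by simp
    show ?thesis
      by (rule that[of n], use AffC in force, rule pair_image_translation[OF k(1)])
        (use b 2 n AffC in \<open>auto simp: left_def right_def reflected_def\<close>)
  next
    case 3
    then have "r + 1 = 2 * (int n + 1)" by (simp add: N_def)
    then have "int n + 1 dvd r + 1" by (metis dvd_triv_right)
    then have b: "b = a + 2" using b cong[of 1] by simp
    show ?thesis
      by (rule that[of 0], use AffC in force, rule pair_image_translation[OF k(3)])
        (use b 3 AffC in \<open>auto simp: left_def right_def reflected_def\<close>)
  next
    case 4
    have "0 < r - int n" "r - int n < int n + 1" using 4 by (simp_all add: N_def)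
    then have "\<not> int n + 1 dvd r + 1 - (int n + 1)"
      using zdvd_not_zless[of "r - int n" "int n + 1"] by simp
    then have "\<not> int n + 1 dvd r + 1"
      using dvd_diff[of "int n + 1" "r + 1" "int n + 1"] dvd_refl by blast
    then have b: "b = a + 1" using b cong[of 1] by simp
    define i where "i = nat (N - r - 1)"
    have i: "int i = N - r - 1" "0 < i" "i < n" using 4 by (auto simp: i_def N_def)
    show ?thesis
      by (rule that[of i], use i AffC in force, rule pair_image_reflection[OF k(2)])
        (use b i AffC in \<open>auto simp: left_def right_def reflected_def\<close>)
  qed
qed

text \<open>For a finite group an invariant part of a finite set is mapped onto itself; for an
  infinite one the vanishing window sums play this role.\<close>

lemma below_iff_above:
  assumes w: "w \<in> elements W n"
  shows "(\<forall>x<a. w x < a) \<longleftrightarrow> (\<forall>x\<ge>a. w x \<ge> a)"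
proof -
  have e: "equivariant w" and inj: "inj w"
    using elements_compatible[OF w] by (auto simp: compatible_def bij_is_inj)
  show ?thesis
  proof (cases "period W n = 0")
    case True
    define F where "F = {- int n..int n}"
    have F: "finite F" by (simp add: F_def)
    have p: "w permutes F"
    proof (cases W)
      case SymA
      then have "w permutes {1..int n}" using w by simp
      then show ?thesis by (rule permutes_subset) (auto simp: F_def)
    next
      case SymB
      then show ?thesis using w by (simp add: F_def)
    qed (use True admissible in auto)
    show ?thesis
    proof (intro iffI allI impI)
      fix x assume "\<forall>x<a. w x < a" "a \<le> x"
      then show "w x \<ge> a" using permutes_invariant_set[OF F p, of "{..<a}" x] by fastforce
    next
      fix x assume "\<forall>x\<ge>a. w x \<ge> a" "x < a"
      then show "w x < a" using permutes_invariant_set[OF F p, of "{a..}" x] by fastforce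
    qed
  next
    case False
    then have N: "period W n > 0" by (cases W) auto
    have shift: "w (x + period W n) = w x + period W n" for x
      by (rule equivariant_translation[OF e]) (simp add: symmetry_def)
    have "(\<Sum>x\<in>{c..<c + period W n}. w x - x) = 0" for c
    proof -
      have s: "(\<Sum>x\<in>{c..<c + period W n}. w x - x) = (\<Sum>x\<in>{d..<d + period W n}. w x - x)" for d
        by (rule sum_periodic) (use shift N in auto)
      show ?thesis
      proof (cases "W = AffA")
        case True
        have "{1..<1 + int n} = {1..int n}" by auto
        moreover have "(\<Sum>x = 1..int n. w x) = (\<Sum>x = 1..int n. id x)"
          using w id_in_elements True unfolding elements_iff by simp
        ultimately show ?thesis using s[of 1] True by (simp add: sum_subtractf)
      next
        case False
        then have W: "W = AffC" using N by (cases W) auto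
        have frozen: "w (int n + 1) = int n + 1" by (rule elements_fixes[OF w]) (simp add: W)
        have odd: "w (- x) = - w x" for x
          using equivariant_reflection[OF e, of 0 x] W by (simp add: symmetry_def reflected_def)
        \<comment> \<open>A full period made of a symmetric interval, on which an odd function has
          sum 0, and the fixed point n+1.\<close>
        have split: "{- int n..<- int n + period W n} = insert (int n + 1) {- int n..int n}"
          using W by auto
        have "(\<Sum>x\<in>{- int n..int n}. w x - x) = (\<Sum>x\<in>{- int n..int n}. - (w x - x))"
          by (rule sum.reindex_bij_witness[of _ uminus uminus]) (auto simp: odd)
        then have "(\<Sum>x\<in>{- int n..int n}. w x - x) = 0" unfolding sum_negf by simp
        then show ?thesis using s[of "- int n"] frozen unfolding split by simp
      qed
    qed
    then show ?thesis
      using periodic_below_imp_above[OF inj shift N, of a] periodic_above_imp_below[OF inj shift N, of a]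
      by blast
  qed
qed

text \<open>Frozen integers are fixed and never cross, so the cut can be read on unfrozen positions
  alone.\<close>

lemma crossing_balance:
  assumes w: "w \<in> elements W n" and ab: "adjacent a b"
  shows "(\<exists>x\<in>unfrozen W n. x \<le> a \<and> b \<le> w x) \<longleftrightarrow> (\<exists>x\<in>unfrozen W n. b \<le> x \<and> w x \<le> a)"
proof -
  have U: "w x \<in> unfrozen W n" if "x \<in> unfrozen W n" for x
    using elements_compatible[OF w] that by (simp add: compatible_def)
  have cut: "x < b \<longleftrightarrow> x \<le> a" if "x \<in> unfrozen W n" for x
    using ab that unfolding adjacent_def by force
  have "(\<forall>x<b. w x < b) \<longleftrightarrow> (\<forall>x\<in>unfrozen W n. x \<le> a \<longrightarrow> w x < b)"
    using cut elements_fixes[OF w] by metis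
  moreover have "(\<forall>x\<ge>b. w x \<ge> b) \<longleftrightarrow> (\<forall>x\<in>unfrozen W n. b \<le> x \<longrightarrow> \<not> w x \<le> a)"
    using cut U elements_fixes[OF w] by (metis linorder_not_less)
  ultimately show ?thesis
    using below_iff_above[OF w, of b] by (metis linorder_not_less)
qed

text \<open>Position \<open>i\<close> belongs to two swapped pairs only, which is why (B) speaks of
  the letter i-1; position i+1 likewise accounts for i+1. If that neighbour indexes no generator,
  only \<open>i\<close> itself moves the position.\<close>

lemma generator_moves_left:
  assumes i: "i \<in> {1..n - 1}" and j: "j \<in> alphabet W n" and moved: "generator W n j (int i) \<noteq> int i"
  shows "j = i \<or> j = letter W n (i - 1)"
proof (cases "W = AffA")
  case True
  have "1 \<le> i" "i < n" "j < n" using i j True by auto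
  have "int n dvd int i - int j \<or> int n dvd int i - (int j + 1)"
    using swaps_moved_congruent[OF swaps_generator[OF j] moved] True
    by (auto simp: reflected_def left_def right_def)
  then have "int i = int j \<or> int i = int j + 1"
    using dvd_small_int[of "int n" "int i - int j"] dvd_small_int[of "int n" "int i - (int j + 1)"]
      \<open>1 \<le> i\<close> \<open>i < n\<close> \<open>j < n\<close> by auto
  then show ?thesis using \<open>i < n\<close> \<open>j < n\<close> by (auto simp: letter_def)
next
  case False
  have "1 \<le> i" "i < n" using i by auto
  then have "int i = left W j \<or> int i = right W n j"
    using generator_fixes_window[OF j False, of "int i"] moved by auto
  then show ?thesis
    using i j False by (auto simp: left_def right_def letter_def split: if_splits)
qed

lemma generator_moves_right:
  assumes i: "i \<in> {1..n - 1}" and j: "j \<in> alphabet W n" and moved: "generator W n j (int i + 1) \<noteq> int i + 1"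
  shows "j = i \<or> j = letter W n (i + 1)"
proof (cases "W = AffA")
  case True
  have "1 \<le> i" "i < n" "j < n" using i j True by auto
  have "int n dvd int i + 1 - int j \<or> int n dvd int i - int j"
    using swaps_moved_congruent[OF swaps_generator[OF j] moved] True
    by (auto simp: reflected_def left_def right_def)
  \<comment> \<open>Wrap-around: position n is moved by the letter 0.\<close>
  moreover have "int i + 1 - int j = 0 \<or> (i + 1 = n \<and> j = 0)" if "int n dvd int i + 1 - int j"
    using dvd_small_int[OF that] \<open>1 \<le> i\<close> \<open>i < n\<close> \<open>j < n\<close> by linarith
  ultimately have "int i = int j \<or> int i + 1 = int j \<or> i + 1 = n \<and> j = 0"
    using dvd_small_int[of "int n" "int i - int j"] \<open>1 \<le> i\<close> \<open>i < n\<close> \<open>j < n\<close> by auto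
  then show ?thesis using True \<open>i < n\<close> \<open>j < n\<close> by (auto simp: letter_def)
next
  case False
  have "1 \<le> i" "i < n" using i by auto
  then have "int i + 1 = left W j \<or> int i + 1 = right W n j"
    using generator_fixes_window[OF j False, of "int i + 1"] moved by auto
  then show ?thesis
    using i j False by (auto simp: left_def right_def letter_def split: if_splits)
qed

lemma left_right_middle:
  assumes "i \<in> {1..n - 1}"
  shows "left W i = int i" "right W n i = int i + 1"
  using assms by (auto simp: left_def right_def)

text \<open>Only \<open>AffC\<close> has two letters outside [n-1]. They move the classes of 1, -1
  and of n, -n modulo 2(n+1), which are disjoint for n at least 2 and equal for n = 1.\<close>

lemma end_letters_disjoint:
  assumes "nondegenerate W n" and i: "i \<in> alphabet W n" and j: "j \<in> alphabet W n" and "i \<noteq> j"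
    and mi: "generator W n i x \<noteq> x" and mj: "generator W n j x \<noteq> x"
  shows "i \<in> {1..n - 1} \<or> j \<in> {1..n - 1}"
proof (cases W)
  case AffC
  have "n \<ge> 2" using assms(1) AffC by simp
  have 0: "2 * (int n + 1) dvd x - 1 \<or> 2 * (int n + 1) dvd x + 1" if "generator W n 0 x \<noteq> x"
    using swaps_moved_congruent[OF swaps_generator that] AffC
    by (auto simp: left_def right_def reflected_def)
  have n: "2 * (int n + 1) dvd x - int n \<or> 2 * (int n + 1) dvd x + int n" if "generator W n n x \<noteq> x"
  proof -
    have *: "2 * (int n + 1) dvd x + int n" if "2 * (int n + 1) dvd x - (int n + 2)"
      using dvd_add[OF that, of "2 * (int n + 1)"] by (simp add: algebra_simps)
    have **: "2 * (int n + 1) dvd x - int n" if "2 * (int n + 1) dvd x + (int n + 2)"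
      using dvd_diff[OF that, of "2 * (int n + 1)"] by (simp add: algebra_simps)
    show ?thesis
      using swaps_moved_congruent[OF swaps_generator \<open>generator W n n x \<noteq> x\<close>] AffC * ** \<open>n \<ge> 2\<close>
      by (auto simp: left_def right_def reflected_def)
  qed
  have nd: "\<not> 2 * (int n + 1) dvd d" if "0 < d" "d < 2 * (int n + 1)" for d
    using zdvd_not_zless that by blast
  have "\<not> (generator W n 0 x \<noteq> x \<and> generator W n n x \<noteq> x)"
    using 0 n nd[of "int n - 1"] nd[of "int n + 1"] \<open>n \<ge> 2\<close>
      dvd_diff[of "2 * (int n + 1)" "x - 1" "x - int n"] dvd_diff[of "2 * (int n + 1)" "x + int n" "x + 1"]
      dvd_diff[of "2 * (int n + 1)" "x + int n" "x - 1"] dvd_diff[of "2 * (int n + 1)" "x + 1" "x - int n"]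
    by (auto simp: algebra_simps)
  moreover have "i = 0 \<or> i = n \<or> i \<in> {1..n - 1}" "j = 0 \<or> j = n \<or> j \<in> {1..n - 1}"
    using i j AffC by auto
  ultimately show ?thesis using \<open>i \<noteq> j\<close> mi mj by blast
qed (use i j \<open>i \<noteq> j\<close> in auto)

lemma end_letter_symmetric:
  assumes "reflected W" "i \<in> alphabet W n" "i \<notin> {1..n - 1}"
  shows "symm (- 1) (left W i + right W n i)"
  using assms by (cases W) (auto simp: reflected_def symmetry_def left_def right_def)

text \<open>Congruent positions are never inverted, so a 321 needs three classes of unfrozen
  positions modulo the period. There are two: all residues modulo 2, or the odd ones modulo
  4.\<close>

lemma degenerate_no_321:
  assumes "\<not> nondegenerate W n" and w: "compatible w"
  shows "\<not> pattern_321 w a b c"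
proof
  assume pat: "pattern_321 w a b c"
  have e: "equivariant w" using w by (simp add: compatible_def)
  have *: "\<not> (period W n dvd y - x)" if "x < y" "w y < w x" for x y
    using equivariant_translation[OF e, of "y - x" x] that by (auto simp: symmetry_def)
  then have no: "\<not> period W n dvd b - a" "\<not> period W n dvd c - b" "\<not> period W n dvd c - a"
    using pat unfolding pattern_321_def by auto
  show False
  proof (cases W)
    case AffA
    then have "n = 2" using admissible assms(1) by simp
    then show ?thesis using no AffA by simp
  next
    case AffC
    then have "n = 1" using admissible assms(1) by simp
    then show ?thesis using no AffC pat unfolding pattern_321_def by simp presburger
  qed (use admissible assms(1) in auto)
qed

end

section \<open>Reduced words\<close>

lemma word_prod_Nil [simp]: "word_prod W n [] = id"
  by (simp add: word_prod_def)

lemma word_prod_Cons [simp]: "word_prod W n (i # u) = generator W n i \<circ> word_prod W n u"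
  by (simp add: word_prod_def)

lemma word_prod_append [simp]: "word_prod W n (u @ v) = word_prod W n u \<circ> word_prod W n v"
  by (induction u) auto

context coxeter_family begin

abbreviation gen :: "nat \<Rightarrow> int \<Rightarrow> int" where
  "gen i \<equiv> generator W n i"

definition descent :: "(int \<Rightarrow> int) \<Rightarrow> nat \<Rightarrow> bool" where
  "descent w i \<longleftrightarrow> w (right W n i) < w (left W i)"

text \<open>The descents that contribute to the disarray.\<close>

definition crossing :: "(int \<Rightarrow> int) \<Rightarrow> nat \<Rightarrow> bool" where
  "crossing w i \<longleftrightarrow> right W n i \<le> w (left W i) \<and> w (right W n i) \<le> left W i"

definition contains_321 :: "(int \<Rightarrow> int) \<Rightarrow> bool" where
  "contains_321 w \<longleftrightarrow> (\<exists>a b c. pattern_321 w a b c)"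

lemma contains_321_iff: "globally_contains_321 W n w \<longleftrightarrow> contains_321 w"
  unfolding globally_contains_321_def contains_321_def pattern_321_def by blast

lemma gen_left_right:
  assumes "i \<in> alphabet W n"
  shows "gen i (left W i) = right W n i" "gen i (right W n i) = left W i"
  using swaps_generator[OF assms] by (simp_all add: swaps_def)

lemma gen_gen: "i \<in> alphabet W n \<Longrightarrow> w \<circ> gen i \<circ> gen i = w"
  using swaps_comp_self[OF swaps_generator] by (simp add: comp_assoc)

lemma left_less_right: "i \<in> alphabet W n \<Longrightarrow> left W i < right W n i"
  using adjacent_letter by (simp add: adjacent_def)

lemma left_right_unfrozen:
  assumes "i \<in> alphabet W n"
  shows "left W i \<in> unfrozen W n" "right W n i \<in> unfrozen W n"
  using adjacent_letter[OF assms] by (simp_all add: adjacent_def)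

lemma unfrozen_cut:
  "adjacent a b \<Longrightarrow> x \<in> unfrozen W n \<Longrightarrow> x \<le> a \<or> b \<le> x"
  by (meson adjacent_def linorder_not_less)

lemma elements_unfrozen: "w \<in> elements W n \<Longrightarrow> x \<in> unfrozen W n \<Longrightarrow> w x \<in> unfrozen W n"
  using elements_compatible by (simp add: compatible_def)

lemma elements_inj: "w \<in> elements W n \<Longrightarrow> inj w"
  using elements_compatible by (simp add: compatible_def bij_is_inj)

lemma elements_equivariant: "w \<in> elements W n \<Longrightarrow> equivariant w"
  using elements_compatible by (simp add: compatible_def)

section \<open>Descents, exchange and length\<close>

lemma no_descent:
  assumes w: "w \<in> elements W n" and i: "i \<in> alphabet W n" and "\<not> descent w i"
  shows "w (left W i) < w (right W n i)"
  using assms(3) left_less_right[OF i] injD[OF elements_inj[OF w]]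
  unfolding descent_def by (metis linorder_neqE order_less_irrefl)

lemma descent_comp_gen:
  assumes w: "w \<in> elements W n" and i: "i \<in> alphabet W n"
  shows "descent (w \<circ> gen i) i \<longleftrightarrow> \<not> descent w i"
  using no_descent[OF w i] gen_left_right[OF i] by (auto simp: descent_def)

lemma descent_at:
  assumes w: "w \<in> elements W n" and "pair_image (left W i) (right W n i) x y" "w x > w y"
  shows "descent w i"
  using pair_image_descent[OF elements_equivariant[OF w] assms(2)] assms(3) by (simp add: descent_def)

lemma word_prod_elements: "set u \<subseteq> alphabet W n \<Longrightarrow> word_prod W n u \<in> elements W n"
  by (induction u rule: rev_induct) (simp_all add: id_in_elements generator_in_elements del: o_apply)

text \<open>The letter that reverses the order of the images of \<open>left W i\<close> and \<open>right W n i\<close> can be deleted.\<close>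

lemma exchange:
  assumes "set u \<subseteq> alphabet W n" and i: "i \<in> alphabet W n" and "descent (word_prod W n u) i"
  obtains u' where "set u' \<subseteq> alphabet W n" "Suc (length u') = length u"
    "word_prod W n u' = word_prod W n u \<circ> gen i"
  using assms(1,3)
proof (induction u arbitrary: thesis)
  case Nil
  then show ?case using left_less_right[OF i] by (simp add: descent_def)
next
  case (Cons j u)
  define f where "f = word_prod W n u"
  have j: "j \<in> alphabet W n" and f: "f \<in> elements W n"
    using Cons.prems(2) word_prod_elements by (simp_all add: f_def)
  show ?case
  proof (cases "descent f i")
    case True
    show ?thesis
    proof (rule Cons.IH)
      show "set u \<subseteq> alphabet W n" using Cons.prems(2) by simp
      show "descent (word_prod W n u) i" using True by (simp add: f_def)
      fix u' assume "set u' \<subseteq> alphabet W n" "Suc (length u') = length u"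
        and "word_prod W n u' = word_prod W n u \<circ> gen i"
      then show ?thesis
        using j by (intro Cons.prems(1)[of "j # u'"]) (simp_all add: comp_assoc)
    qed
  next
    case False
    have less: "f (left W i) < f (right W n i)" by (rule no_descent[OF f i False])
    have "gen j (f (left W i)) > gen j (f (right W n i))"
      using Cons.prems(3) by (simp add: descent_def f_def)
    \<comment> \<open>The letter \<open>j\<close> is the one that reverses the two images; they form
      a pair swapped by \<open>j\<close>, so \<open>gen i\<close> moves through \<open>f\<close> and
      becomes \<open>gen j\<close>, which cancels.\<close>
    then have "pair_image (left W j) (right W n j) (f (left W i)) (f (right W n i))"
      by (rule swaps_inversion[OF swaps_generator[OF j] adjacent_letter[OF j]
            elements_unfrozen[OF f left_right_unfrozen(1)[OF i]]
            elements_unfrozen[OF f left_right_unfrozen(2)[OF i]] less])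
    then have "f \<circ> gen i = gen j \<circ> f"
      by (intro swaps_conjugate[OF elements_compatible[OF f] swaps_generator[OF i]]
          swaps_image[OF swaps_generator[OF j]])
    then have "word_prod W n (j # u) \<circ> gen i = gen j \<circ> (gen j \<circ> f)"
      by (simp add: f_def comp_assoc)
    also have "\<dots> = f"
      using swaps_comp_self[OF swaps_generator[OF j]] by (simp add: comp_assoc[symmetric])
    finally show ?thesis
      using Cons.prems(1)[of u] Cons.prems(2) by (simp add: f_def del: word_prod_Cons)
  qed
qed

text \<open>Without descents \<open>w\<close> increases on \<open>U\<close>. A position next to a
  cut that crosses it would need, by balance, a partner crossing the other way, and the two would
  form an inversion.\<close>

lemma no_descent_imp_id:
  assumes w: "w \<in> elements W n" and no: "\<And>i. i \<in> alphabet W n \<Longrightarrow> \<not> descent w i"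
  shows "w = id"
proof -
  have mono: "\<not> w x > w y" if "x \<in> unfrozen W n" "y \<in> unfrozen W n" "x < y" for x y
  proof
    assume "w x > w y"
    from descent_between[OF that this] obtain a b where "adjacent a b" "w a > w b" by blast
    then show False using adjacent_pair_image descent_at[OF w] no by metis
  qed
  have le: "w a \<le> a" and ge: "w b \<ge> b" if ab: "adjacent a b" for a b
  proof -
    have U: "a \<in> unfrozen W n" "b \<in> unfrozen W n" "a < b" using ab by (auto simp: adjacent_def)
    show "w a \<le> a"
    proof (rule ccontr)
      assume "\<not> w a \<le> a"
      then have "b \<le> w a" using unfrozen_cut[OF ab elements_unfrozen[OF w U(1)]] by simp
      then obtain x where "x \<in> unfrozen W n" "b \<le> x" "w x \<le> a"
        using crossing_balance[OF w ab] U(1) by blast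
      then show False using mono[of a x] U \<open>b \<le> w a\<close> by auto
    qed
    show "w b \<ge> b"
    proof (rule ccontr)
      assume "\<not> w b \<ge> b"
      then have "w b \<le> a" using unfrozen_cut[OF ab elements_unfrozen[OF w U(2)]] by simp
      then obtain x where "x \<in> unfrozen W n" "x \<le> a" "b \<le> w x"
        using crossing_balance[OF w ab] U(2) by blast
      then show False using mono[of x b] U \<open>w b \<le> a\<close> by auto
    qed
  qed
  have "w x = x" for x
  proof (cases "x \<in> unfrozen W n")
    case True
    note wx = elements_unfrozen[OF w True]
    have "w x \<ge> x"
    proof (rule ccontr)
      assume "\<not> w x \<ge> x"
      then obtain a where "adjacent a x" using adjacent_predecessor[OF wx True] by auto
      then show False using ge \<open>\<not> w x \<ge> x\<close> by blast
    qed
    moreover have "w x \<le> x"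
    proof (rule ccontr)
      assume "\<not> w x \<le> x"
      then obtain b where "adjacent x b" using adjacent_successor[OF True wx] by auto
      then show False using le \<open>\<not> w x \<le> x\<close> by blast
    qed
    ultimately show ?thesis by simp
  next
    case False
    then show ?thesis by (rule elements_fixes[OF w])
  qed
  then show ?thesis by auto
qed

text \<open>
  The disarray itself can be unchanged when a descent is undone; the sum of squares always drops and
  so shows that the generators generate.
\<close>

lemma square_displacement_descent:
  assumes w: "w \<in> elements W n" and i: "i \<in> alphabet W n" and d: "descent w i"
  shows "displacement n (\<lambda>d. d * d) (w \<circ> gen i) < displacement n (\<lambda>d. d * d) w"
proof -
  let ?l = "left W i" and ?r = "right W n i"
  have "(?r - ?l) * (displacement n (\<lambda>d. d * d) (w \<circ> gen i) - displacement n (\<lambda>d. d * d) w)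
      = (?r - ?l) * (2 * (w ?r - w ?l))"
    unfolding displacement_generator[OF w i, of "\<lambda>d. d * d", simplified] by (simp add: algebra_simps)
  then have "displacement n (\<lambda>d. d * d) (w \<circ> gen i) - displacement n (\<lambda>d. d * d) w = 2 * (w ?r - w ?l)"
    using left_less_right[OF i] by simp
  then show ?thesis using d by (simp add: descent_def)
qed

lemma ex_word: "w \<in> elements W n \<Longrightarrow> \<exists>u. word_for W n u w"
proof (induction "nat (displacement n (\<lambda>d. d * d) w)" arbitrary: w rule: less_induct)
  case less
  show ?case
  proof (cases "\<exists>i\<in>alphabet W n. descent w i")
    case True
    then obtain i where i: "i \<in> alphabet W n" "descent w i" by blast
    have "0 \<le> displacement n (\<lambda>d. d * d) (w \<circ> gen i)"
      unfolding displacement_def by (rule sum_nonneg) simp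
    then have "nat (displacement n (\<lambda>d. d * d) (w \<circ> gen i)) < nat (displacement n (\<lambda>d. d * d) w)"
      using square_displacement_descent[OF less.prems i] by simp
    from less.hyps[OF this generator_in_elements[OF less.prems i(1)]]
    obtain u where "word_for W n u (w \<circ> gen i)" ..
    then have "word_for W n (u @ [i]) w"
      using i(1) gen_gen[OF i(1)] by (simp add: word_for_def)
    then show ?thesis ..
  next
    case False
    then have "w = id" using no_descent_imp_id[OF less.prems] by blast
    then have "word_for W n [] w" by (simp add: word_for_def)
    then show ?thesis ..
  qed
qed

lemma coxeter_length_le: "word_for W n u w \<Longrightarrow> coxeter_length W n w \<le> length u"
  unfolding coxeter_length_def by (rule Least_le) blast

lemma ex_reduced_word:
  assumes "w \<in> elements W n"
  obtains u where "reduced_word W n u w"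
proof -
  have "\<exists>l u. word_for W n u w \<and> length u = l" using ex_word[OF assms] by blast
  from LeastI_ex[OF this] show thesis
    using that unfolding reduced_word_def coxeter_length_def by blast
qed

text \<open>Appending the letter bounds the length from above, deleting one by
  \<open>exchange\<close> bounds it from below.\<close>

lemma coxeter_length_descent:
  assumes w: "w \<in> elements W n" and i: "i \<in> alphabet W n" and d: "descent w i"
  shows "coxeter_length W n w = Suc (coxeter_length W n (w \<circ> gen i))"
proof (rule antisym)
  obtain u where u: "reduced_word W n u (w \<circ> gen i)"
    using ex_reduced_word[OF generator_in_elements[OF w i]] .
  then have "word_for W n (u @ [i]) w"
    using i gen_gen[OF i] by (simp add: word_for_def reduced_word_def)
  from coxeter_length_le[OF this] show "coxeter_length W n w \<le> Suc (coxeter_length W n (w \<circ> gen i))"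
    using u by (simp add: reduced_word_def)
next
  obtain u where u: "reduced_word W n u w" using ex_reduced_word[OF w] .
  then have "set u \<subseteq> alphabet W n" "descent (word_prod W n u) i"
    using d by (auto simp: reduced_word_def word_for_def)
  from exchange[OF this(1) i this(2)] obtain u' where
    u': "set u' \<subseteq> alphabet W n" "Suc (length u') = length u" "word_prod W n u' = word_prod W n u \<circ> gen i" .
  then have "word_for W n u' (w \<circ> gen i)"
    using u by (simp add: reduced_word_def word_for_def)
  from coxeter_length_le[OF this] show "Suc (coxeter_length W n (w \<circ> gen i)) \<le> coxeter_length W n w"
    using u u'(2) by (simp add: reduced_word_def)
qed

lemma reduced_word_elements: "reduced_word W n u w \<Longrightarrow> w \<in> elements W n"
  using word_prod_elements by (auto simp: reduced_word_def word_for_def)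

lemma reduced_word_append:
  assumes w: "w \<in> elements W n" and i: "i \<in> alphabet W n" and d: "descent w i"
    and u: "reduced_word W n u (w \<circ> gen i)"
  shows "reduced_word W n (u @ [i]) w"
  using u i gen_gen[OF i] coxeter_length_descent[OF w i d] by (simp add: word_for_def reduced_word_def)

lemma reduced_word_butlast:
  assumes u: "reduced_word W n (u @ [i]) w"
  shows "i \<in> alphabet W n" "reduced_word W n u (w \<circ> gen i)" "descent w i"
proof -
  have w: "w \<in> elements W n" by (rule reduced_word_elements[OF u])
  show i: "i \<in> alphabet W n" using u by (auto simp: reduced_word_def word_for_def)
  have "set u \<subseteq> alphabet W n" and p: "word_prod W n u \<circ> gen i = w"
    using u by (auto simp: reduced_word_def word_for_def)
  then have wf: "word_for W n u (w \<circ> gen i)"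
    using gen_gen[OF i, of "word_prod W n u"] by (auto simp: word_for_def)
  show d: "descent w i"
  proof (rule ccontr)
    assume "\<not> descent w i"
    then have "descent (w \<circ> gen i) i" using descent_comp_gen[OF w i] by simp
    from coxeter_length_descent[OF generator_in_elements[OF w i] i this]
    show False using coxeter_length_le[OF wf] u gen_gen[OF i, of w] by (simp add: reduced_word_def)
  qed
  show "reduced_word W n u (w \<circ> gen i)"
    using wf u coxeter_length_descent[OF w i d] by (simp add: reduced_word_def)
qed

section \<open>Disarray of a single step\<close>

lemma disarray_eq_displacement: "disarray n w = displacement n abs w"
  by (simp add: disarray_def displacement_def)

lemma disarray_descent:
  assumes w: "w \<in> elements W n" and i: "i \<in> alphabet W n" and d: "descent w i"
  shows "disarray n w = disarray n (w \<circ> gen i) + (if crossing w i then 2 else 0)"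
proof -
  let ?l = "left W i" and ?r = "right W n i"
  \<comment> \<open>The side of the cut on which a value lies. Values are unfrozen, so none lies
    strictly between the two positions and the distances to them differ by exactly
    \<open>?r - ?l\<close>.\<close>
  define s where "s = (\<lambda>x::int. if ?r \<le> x then 1 else - 1 :: int)"
  have lr: "?l < ?r" by (rule left_less_right[OF i])
  have cut: "w ?l \<le> ?l \<or> ?r \<le> w ?l" "w ?r \<le> ?l \<or> ?r \<le> w ?r"
    using unfrozen_cut[OF adjacent_letter[OF i] elements_unfrozen[OF w]] left_right_unfrozen[OF i] by blast+
  have s: "\<bar>w x - ?l\<bar> - \<bar>w x - ?r\<bar> = (?r - ?l) * s (w x)" if "w x \<le> ?l \<or> ?r \<le> w x" for x
    using that lr by (auto simp: s_def)
  have "(?r - ?l) * (disarray n (w \<circ> gen i) - disarray n w) =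
      \<bar>w ?r - ?l\<bar> + \<bar>w ?l - ?r\<bar> - \<bar>w ?l - ?l\<bar> - \<bar>w ?r - ?r\<bar>"
    unfolding disarray_eq_displacement by (rule displacement_generator[OF w i]) simp
  also have "\<dots> = (?r - ?l) * (s (w ?r) - s (w ?l))"
    using s[OF cut(1)] s[OF cut(2)] by (simp add: right_diff_distrib)
  finally have "disarray n (w \<circ> gen i) - disarray n w = s (w ?r) - s (w ?l)"
    using lr by simp
  then show ?thesis
    using d cut lr by (auto simp: s_def crossing_def descent_def split: if_splits)
qed

end

context orbits begin

text \<open>Moving the whole pattern by a symmetry puts the pair at \<open>x\<close>,
  \<open>y\<close> itself; a reflection turns a first pair into a last one, hence the two
  outcomes.\<close>

lemma pattern_321_transport:
  assumes e: "equivariant w" and pat: "pattern_321 w a b c"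
    and im: "pair_image x y a b \<or> pair_image x y b c"
  obtains d where "pattern_321 w x y d" | d where "pattern_321 w d x y"
proof -
  have U: "a \<in> U" "b \<in> U" "c \<in> U" "a < b" "b < c" "w a > w b" "w b > w c"
    using pat by (auto simp: pattern_321_def)
  have translated: "pattern_321 w (a + k) (b + k) (c + k)" if "symm 1 k" for k
    using U U_translation[OF that] equivariant_translation[OF e that] by (simp add: pattern_321_def)
  have reflected: "pattern_321 w (k - c) (k - b) (k - a)" if "symm (- 1) k" for k
    using U U_reflection[OF that] equivariant_reflection[OF e that] by (simp add: pattern_321_def)
  from im have "pair_image a b x y \<or> pair_image b c x y"
    using pair_image_sym by blast
  then consider k where "symm 1 k" "x = a + k" "y = b + k" | k where "symm (- 1) k" "x = k - b" "y = k - a"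
    | k where "symm 1 k" "x = b + k" "y = c + k" | k where "symm (- 1) k" "x = k - c" "y = k - b"
    unfolding pair_image_def by blast
  then show thesis
    by cases (use translated reflected that in blast)+
qed

end

context coxeter_family begin

section \<open>The equivalences\<close>

lemma contains_321_comp_gen:
  assumes w: "w \<in> elements W n" and i: "i \<in> alphabet W n" and d: "descent w i"
    and "contains_321 (w \<circ> gen i)"
  shows "contains_321 w"
  using pattern_321_swaps[OF elements_compatible[OF w] swaps_generator[OF i] adjacent_letter[OF i]]
    assms(3,4) unfolding contains_321_def descent_def by blast

lemma avoids_imp_crossing:
  assumes w: "w \<in> elements W n" and i: "i \<in> alphabet W n" and d: "descent w i"
    and avoid: "\<not> contains_321 w"
  shows "crossing w i"
proof -
  let ?l = "left W i" and ?r = "right W n i"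
  note ab = adjacent_letter[OF i] and U = left_right_unfrozen[OF i] and lr = left_less_right[OF i]
  have cut: "w ?l \<le> ?l \<or> ?r \<le> w ?l" "w ?r \<le> ?l \<or> ?r \<le> w ?r"
    using unfrozen_cut[OF ab elements_unfrozen[OF w]] U by blast+
  have "?r \<le> w ?l"
  proof (rule ccontr)
    assume "\<not> ?r \<le> w ?l"
    then have "w ?l \<le> ?l" "w ?r \<le> ?l" using cut d by (auto simp: descent_def)
    \<comment> \<open>The value at \<open>?r\<close> crosses downwards, so another value crosses
      upwards; it does not stand at \<open>?l\<close>, hence it stands further left.\<close>
    then obtain x where x: "x \<in> unfrozen W n" "x \<le> ?l" "?r \<le> w x"
      using crossing_balance[OF w ab] U by blast
    then have "x \<noteq> ?l" using \<open>\<not> ?r \<le> w ?l\<close> by auto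
    then have "pattern_321 w x ?l ?r"
      using x U lr d \<open>w ?l \<le> ?l\<close> by (simp add: pattern_321_def descent_def)
    then show False using avoid by (auto simp: contains_321_def)
  qed
  moreover have "w ?r \<le> ?l"
  proof (rule ccontr)
    assume "\<not> w ?r \<le> ?l"
    then have "?r \<le> w ?r" using cut by auto
    then obtain x where x: "x \<in> unfrozen W n" "?r \<le> x" "w x \<le> ?l"
      using crossing_balance[OF w ab] U \<open>?r \<le> w ?l\<close> lr by fastforce
    then have "x \<noteq> ?r" using \<open>\<not> w ?r \<le> ?l\<close> by auto
    then have "pattern_321 w ?l ?r x"
      using x U lr d \<open>?r \<le> w ?r\<close> by (simp add: pattern_321_def descent_def)
    then show False using avoid by (auto simp: contains_321_def)
  qed
  ultimately show ?thesis by (simp add: crossing_def)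
qed

text \<open>If the step created the first 321, that pattern would contain an image of the swapped
  pair. Its third member crosses the cut in \<open>w \<circ> gen i\<close>; balance supplies a
  crossing the other way, and with the uncrossed value at \<open>?l\<close> or \<open>?r\<close>
  they form a 321 before the step.\<close>

lemma crossing_contains_321:
  assumes w: "w \<in> elements W n" and i: "i \<in> alphabet W n"
    and cross: "crossing w i" and contains: "contains_321 w"
  shows "contains_321 (w \<circ> gen i)"
proof (rule ccontr)
  let ?l = "left W i" and ?r = "right W n i" and ?v = "w \<circ> gen i"
  assume avoid: "\<not> contains_321 ?v"
  note ab = adjacent_letter[OF i] and U = left_right_unfrozen[OF i] and lr = left_less_right[OF i]
    and s = swaps_generator[OF i]
  have v: "?v \<in> elements W n" by (rule generator_in_elements[OF w i])
  have vl: "?v ?l \<le> ?l" and vr: "?r \<le> ?v ?r"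
    using cross gen_left_right[OF i] by (simp_all add: crossing_def)
  have vgen: "?v (gen i x) = w x" for x using swaps_involution[OF s] by simp
  have gU: "gen i x \<in> unfrozen W n" if "x \<in> unfrozen W n" for x by (rule swaps_U[OF s ab that])
  have gen_inj: "gen i x = gen i y \<Longrightarrow> x = y" for x y using swaps_involution[OF s] by metis
  obtain a b c where pat: "pattern_321 w a b c" using contains by (auto simp: contains_321_def)
  then have "\<not> pattern_321 ?v (gen i a) (gen i b) (gen i c)"
    using avoid by (auto simp: contains_321_def)
  from pattern_321_broken[OF s ab pat this]
  have "pair_image ?l ?r a b \<or> pair_image ?l ?r b c" .
  from pattern_321_transport[OF elements_equivariant[OF w] pat this]
  consider d where "pattern_321 w ?l ?r d" | d where "pattern_321 w d ?l ?r" by blast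
  then show False
  proof cases
    case (1 d)
    then have d: "d \<in> unfrozen W n" "?r < d" "w ?r > w d" by (auto simp: pattern_321_def)
    \<comment> \<open>\<open>gen i\<close> may move \<open>d\<close>, but not past
      \<open>?l\<close>: it would then reverse \<open>?r\<close> and \<open>d\<close>, although
      \<open>?r\<close> is exchanged with \<open>?l\<close>.\<close>
    have "\<not> ?l > gen i d"
      using swaps_inversion[OF s ab U(2) d(1,2)] swaps_image[OF s, of ?r d] gen_left_right[OF i] d lr
      by (auto simp: swaps_def)
    moreover have "gen i d \<noteq> ?l" using gen_inj[of d ?r] gen_left_right[OF i] d by auto
    ultimately have ld: "?l < gen i d" by simp
    have vd: "?v (gen i d) < ?v ?l" using vgen d gen_left_right[OF i] by simp
    have "?r \<le> gen i d" using unfrozen_cut[OF ab gU[OF d(1)]] ld by simp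
    moreover have "?v (gen i d) \<le> ?l" using vd vl by simp
    ultimately obtain x where x: "x \<in> unfrozen W n" "x \<le> ?l" "?r \<le> ?v x"
      using crossing_balance[OF v ab] gU[OF d(1)] by blast
    have "x \<noteq> ?l" using x(3) vl lr by auto
    then have "pattern_321 ?v x ?l (gen i d)"
      unfolding pattern_321_def using x U gU[OF d(1)] ld vd vl lr by auto
    then show False using avoid by (auto simp: contains_321_def)
  next
    case (2 d)
    then have d: "d \<in> unfrozen W n" "d < ?l" "w d > w ?l" by (auto simp: pattern_321_def)
    have "\<not> gen i d > ?r"
      using swaps_inversion[OF s ab d(1) U(1) d(2)] swaps_image[OF s, of d ?l] gen_left_right[OF i] d lr
      by (auto simp: swaps_def)
    moreover have "gen i d \<noteq> ?r" using gen_inj[of d ?l] gen_left_right[OF i] d by auto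
    ultimately have dr: "gen i d < ?r" by simp
    have vd: "?v (gen i d) > ?v ?r" using vgen d gen_left_right[OF i] by simp
    have "gen i d \<le> ?l" using unfrozen_cut[OF ab gU[OF d(1)]] dr by simp
    moreover have "?r \<le> ?v (gen i d)" using vd vr by simp
    ultimately obtain x where x: "x \<in> unfrozen W n" "?r \<le> x" "?v x \<le> ?l"
      using crossing_balance[OF v ab] gU[OF d(1)] by blast
    have "x \<noteq> ?r" using x(3) vr lr by auto
    then have "pattern_321 ?v (gen i d) ?r x"
      unfolding pattern_321_def using x U gU[OF d(1)] dr vd vr lr by auto
    then show False using avoid by (auto simp: contains_321_def)
  qed
qed

text \<open>The inequality belongs to the induction: equality for the whole word then forces
  equality for the prefix and a crossing last step.\<close>

lemma reduced_word_disarray: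
  "reduced_word W n u w \<Longrightarrow> disarray n w \<le> 2 * int (length u) \<and>
     (disarray n w = 2 * int (length u) \<longleftrightarrow> \<not> contains_321 w)"
proof (induction u arbitrary: w rule: rev_induct)
  case Nil
  then have "w = id" by (simp add: reduced_word_def word_for_def)
  then show ?case by (simp add: disarray_def contains_321_def pattern_321_def)
next
  case (snoc i u)
  note u = reduced_word_butlast[OF snoc.prems]
  have w: "w \<in> elements W n" by (rule reduced_word_elements[OF snoc.prems])
  have "\<not> contains_321 w \<longleftrightarrow> \<not> contains_321 (w \<circ> gen i) \<and> crossing w i"
    using contains_321_comp_gen[OF w u(1,3)] avoids_imp_crossing[OF w u(1,3)]
      crossing_contains_321[OF w u(1)] by blast
  moreover define v where "v = w \<circ> gen i"
  moreover have "disarray n v \<le> 2 * int (length u) \<and>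
      (disarray n v = 2 * int (length u) \<longleftrightarrow> \<not> contains_321 v)"
    unfolding v_def by (rule snoc.IH[OF u(2)])
  moreover have "disarray n w = disarray n v + (if crossing w i then 2 else 0)"
    unfolding v_def by (rule disarray_descent[OF w u(1,3)])
  ultimately show ?case
    unfolding v_def[symmetric] by (cases "crossing w i") auto
qed

text \<open>Equality leaves no slack, so every letter crosses. Seen from the prefix before it, both
  values are still on their own side of the cut.\<close>

lemma prefix_crossing:
  "reduced_word W n u w \<Longrightarrow> disarray n w = 2 * int (length u) \<Longrightarrow> k < length u \<Longrightarrow>
    word_prod W n (take k u) (left W (u ! k)) \<le> left W (u ! k) \<and>
    right W n (u ! k) \<le> word_prod W n (take k u) (right W n (u ! k))"
proof (induction u arbitrary: w rule: rev_induct)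
  case Nil
  then show ?case by simp
next
  case (snoc i u)
  note u = reduced_word_butlast[OF snoc.prems(1)]
  have w: "w \<in> elements W n" by (rule reduced_word_elements[OF snoc.prems(1)])
  have "disarray n (w \<circ> gen i) \<le> 2 * int (length u)" using reduced_word_disarray[OF u(2)] by simp
  then have eq: "disarray n (w \<circ> gen i) = 2 * int (length u)" and cross: "crossing w i"
    using disarray_descent[OF w u(1,3)] snoc.prems(2) by (simp_all split: if_splits)
  show ?case
  proof (cases "k < length u")
    case True
    then show ?thesis using snoc.IH[OF u(2) eq] by (simp add: nth_append)
  next
    case False
    then have k: "k = length u" using snoc.prems(3) by simp
    have "word_prod W n u = w \<circ> gen i" using u(2) by (simp add: reduced_word_def word_for_def)
    then show ?thesis using k cross gen_left_right[OF u(1)] by (simp add: crossing_def)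
  qed
qed

section \<open>Separation of equal letters and absence of braids\<close>

lemma word_prod_take_fixed:
  assumes "\<And>k. p < k \<Longrightarrow> k < q \<Longrightarrow> gen (u ! k) x = x" and "p < q" "q \<le> length u"
  shows "word_prod W n (take q u) x = word_prod W n (take (Suc p) u) x"
proof -
  have "Suc p \<le> q" using assms(2) by simp
  then show ?thesis
    using assms(1,3)
  proof (induction q rule: dec_induct)
    case (step m)
    then show ?case by (simp add: take_Suc_conv_app_nth)
  qed simp
qed

lemma copies_separated_if_disarray:
  assumes u: "reduced_word W n u w" and eq: "disarray n w = 2 * int (length u)"
  shows "copies_separated W n u"
  unfolding copies_separated_def
proof (intro ballI allI impI)
  fix i p q' assume i: "i \<in> {1..n - 1}" and "p < q' \<and> q' < length u \<and> u ! p = i \<and> u ! q' = i"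
  \<comment> \<open>The next copy after \<open>p\<close>: what occurs before it also occurs before
    \<open>q'\<close>, and no letter \<open>i\<close> in between disturbs the two positions.\<close>
  define q where "q = (LEAST k. p < k \<and> u ! k = i)"
  have *: "p < q' \<and> u ! q' = i" and "q' < length u" "u ! p = i"
    using \<open>p < q' \<and> q' < length u \<and> u ! p = i \<and> u ! q' = i\<close> by auto
  have q: "p < q" "u ! q = i" "q \<le> q'"
    using LeastI[of "\<lambda>k. p < k \<and> u ! k = i", OF *] Least_le[of "\<lambda>k. p < k \<and> u ! k = i", OF *]
    by (auto simp: q_def)
  then have "q < length u" "p < length u" using \<open>q' < length u\<close> by auto
  have no: "u ! k \<noteq> i" if "p < k" "k < q" for k
    using not_less_Least[of k "\<lambda>k. p < k \<and> u ! k = i"] that by (auto simp: q_def)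
  have alph: "u ! k \<in> alphabet W n" if "k < length u" for k
    using u that nth_mem by (auto simp: reduced_word_def word_for_def)
  have iA: "i \<in> alphabet W n" using alph[OF \<open>p < length u\<close>] \<open>u ! p = i\<close> by simp
  note lr = left_right_middle[OF i]
  have at_p: "word_prod W n (take p u) (int i) \<le> int i" "int i + 1 \<le> word_prod W n (take p u) (int i + 1)"
    using prefix_crossing[OF u eq \<open>p < length u\<close>] \<open>u ! p = i\<close> lr by auto
  have at_q: "word_prod W n (take q u) (int i) \<le> int i" "int i + 1 \<le> word_prod W n (take q u) (int i + 1)"
    using prefix_crossing[OF u eq \<open>q < length u\<close>] q(2) lr by auto
  have "word_prod W n (take (Suc p) u) = word_prod W n (take p u) \<circ> gen i"
    using \<open>p < length u\<close> \<open>u ! p = i\<close> by (simp add: take_Suc_conv_app_nth)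
  then have after_p: "word_prod W n (take (Suc p) u) (int i) \<ge> int i + 1"
      "word_prod W n (take (Suc p) u) (int i + 1) \<le> int i"
    using at_p gen_left_right[OF iA] lr by simp_all
  have "occurs_between (letter W n (i - 1)) u p q"
  proof (rule ccontr)
    assume "\<not> ?thesis"
    then have "gen (u ! k) (int i) = int i" if "p < k" "k < q" for k
      using generator_moves_left[OF i alph[of k]] no[OF that] that \<open>q < length u\<close>
      by (auto simp: occurs_between_def)
    from word_prod_take_fixed[OF this q(1)] show False
      using at_q after_p \<open>q < length u\<close> by simp
  qed
  moreover have "occurs_between (letter W n (i + 1)) u p q"
  proof (rule ccontr)
    assume "\<not> ?thesis"
    then have "gen (u ! k) (int i + 1) = int i + 1" if "p < k" "k < q" for k
      using generator_moves_right[OF i alph[of k]] no[OF that] that \<open>q < length u\<close>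
      by (auto simp: occurs_between_def)
    from word_prod_take_fixed[OF this q(1)] show False
      using at_q after_p \<open>q < length u\<close> by simp
  qed
  ultimately show "occurs_between (letter W n (i - 1)) u p q' \<and> occurs_between (letter W n (i + 1)) u p q'"
    using q(3) unfolding occurs_between_def by (meson order_less_le_trans)
qed

text \<open>The single letter between two copies of \<open>i\<close> would have to be both
  neighbours. These coincide only in \<open>AffA\<close> with n = 2.\<close>

lemma copies_separated_imp_braid_free:
  assumes "nondegenerate W n" and sep: "copies_separated W n u"
  shows "braid_free W n u"
proof -
  have False if i: "i \<in> {1..n - 1}" and sub: "sublist [i, x, i] u" for i x
  proof -
    obtain xs ys where u: "u = xs @ [i, x, i] @ ys" using sub unfolding sublist_def by blast
    let ?p = "length xs"
    have nth: "u ! ?p = i" "u ! (?p + 1) = x" "u ! (?p + 2) = i" "?p + 2 < length u"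
      by (simp_all add: u nth_append)
    have "occurs_between (letter W n (i - 1)) u ?p (?p + 2) \<and>
        occurs_between (letter W n (i + 1)) u ?p (?p + 2)"
      using sep i nth unfolding copies_separated_def by (metis less_add_same_cancel1 pos2)
    moreover have "k = ?p + 1" if "?p < k" "k < ?p + 2" for k using that by simp
    ultimately have "letter W n (i - 1) = letter W n (i + 1)"
      using nth(2) unfolding occurs_between_def by metis
    then show False using i assms(1) by (auto simp: letter_def split: if_splits)
  qed
  then show ?thesis unfolding braid_free_def by blast
qed

section \<open>Braids from 321 patterns\<close>

lemma neighbouring_letters:
  assumes i: "i \<in> {1..n - 1}" "i \<in> alphabet W n" and j: "j \<in> alphabet W n" and "i \<noteq> j"
    and mi: "gen i x \<noteq> x" and mj: "gen j x \<noteq> x"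
  shows "j = letter W n (i - 1) \<or> j = letter W n (i + 1)"
proof -
  obtain e k where ek: "symm e k" "x = e * int i + k \<or> x = e * (int i + 1) + k"
    using swaps_generator[OF i(2)] mi left_right_middle[OF i(1)] unfolding swaps_def by metis
  have "equivariant (gen j)" using swaps_generator[OF j] by (simp add: swaps_def)
  \<comment> \<open>The common moved point is an image of position \<open>i\<close> or
    \<open>i + 1\<close>, so \<open>j\<close> moves one of these.\<close>
  from equivariantD[OF this ek(1)] have "gen j (int i) \<noteq> int i \<or> gen j (int i + 1) \<noteq> int i + 1"
    using ek(2) mj by metis
  then show ?thesis
    using generator_moves_left[OF i(1) j] generator_moves_right[OF i(1) j] \<open>i \<noteq> j\<close> by blast
qed

text \<open>Three successive descents are peeled off the right end. Only the outer letter must lie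
  in [n-1]; the middle one may be an end letter.\<close>

lemma braid_reduced_word:
  assumes w: "w \<in> elements W n" and i: "i \<in> {1..n - 1}" "i \<in> alphabet W n" and j: "j \<in> alphabet W n"
    and "i \<noteq> j" and moved: "gen i x \<noteq> x" "gen j x \<noteq> x"
    and desc: "descent w i" "descent (w \<circ> gen i) j" "descent (w \<circ> gen i \<circ> gen j) i"
  obtains u where "reduced_word W n u w" "\<not> braid_free W n u"
proof -
  have w1: "w \<circ> gen i \<in> elements W n" by (rule generator_in_elements[OF w i(2)])
  have w2: "w \<circ> gen i \<circ> gen j \<in> elements W n" by (rule generator_in_elements[OF w1 j])
  obtain u where "reduced_word W n u (w \<circ> gen i \<circ> gen j \<circ> gen i)"
    using ex_reduced_word[OF generator_in_elements[OF w2 i(2)]] .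
  then have "reduced_word W n (((u @ [i]) @ [j]) @ [i]) w"
    by (intro reduced_word_append[OF w i(2) desc(1)] reduced_word_append[OF w1 j desc(2)]
        reduced_word_append[OF w2 i(2) desc(3)])
  then have "reduced_word W n (u @ [i, j, i]) w" by simp
  moreover have "\<not> braid_free W n (u @ [i, j, i])"
    using neighbouring_letters[OF i j \<open>i \<noteq> j\<close> moved] i(1) unfolding braid_free_def by auto
  ultimately show thesis by (rule that)
qed

lemma braid_of_triple:
  assumes "nondegenerate W n" and w: "w \<in> elements W n" and triple: "descending_triple w p q c"
  obtains u where "reduced_word W n u w" "\<not> braid_free W n u"
proof -
  have pq: "adjacent p q" and qc: "adjacent q c" and desc: "w p > w q" "w q > w c"
    using triple by (auto simp: descending_triple_def)
  obtain i where i: "i \<in> alphabet W n" "pair_image (left W i) (right W n i) p q"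
    using adjacent_pair_image[OF pq] .
  obtain j where j: "j \<in> alphabet W n" "pair_image (left W j) (right W n j) q c"
    using adjacent_pair_image[OF qc] .
  have s: "swaps (gen i) p q" by (rule swaps_image[OF swaps_generator[OF i(1)] i(2)])
  have t: "swaps (gen j) q c" by (rule swaps_image[OF swaps_generator[OF j(1)] j(2)])
  have less: "p < q" "q < c" using pq qc by (auto simp: adjacent_def)
  have images: "gen i q = p" "gen j q = c"
    using s t by (simp_all add: swaps_def)
  then have moved: "gen i q \<noteq> q" "gen j q \<noteq> q" using less by simp_all
  have "i \<noteq> j" using images less by auto
  note chain = triple_descents[OF elements_equivariant[OF w] s t pq qc desc]
  note w1 = generator_in_elements[OF w]
  note w2 = generator_in_elements[OF w1]
  have "i \<in> {1..n - 1} \<or> j \<in> {1..n - 1}"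
    by (rule end_letters_disjoint[OF assms(1) i(1) j(1) \<open>i \<noteq> j\<close> moved])
  then show thesis
  proof
    assume "i \<in> {1..n - 1}"
    then show thesis
      by (rule braid_reduced_word[OF w _ i(1) j(1) \<open>i \<noteq> j\<close> moved descent_at[OF w i(2) desc(1)]
          descent_at[OF w1[OF i(1)] j(2) chain(1)] descent_at[OF w2[OF i(1) j(1)] i(2) chain(2)] that])
  next
    assume "j \<in> {1..n - 1}"
    then show thesis
      by (rule braid_reduced_word[OF w _ j(1) i(1) \<open>i \<noteq> j\<close>[symmetric] moved(2,1) descent_at[OF w j(2) desc(2)]
          descent_at[OF w1[OF j(1)] i(2) chain(3)] descent_at[OF w2[OF j(1) i(1)] j(2) chain(4)] that])
  qed
qed

text \<open>Unlike for a triple, only one order of the letters is available, so the outer letter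
  \<open>i\<close> itself must be shown not to be an end letter.\<close>

lemma braid_of_symmetric_4231:
  assumes "nondegenerate W n" and w: "w \<in> elements W n" and quad: "symmetric_4231 w m p q"
  obtains u where "reduced_word W n u w" "\<not> braid_free W n u"
proof -
  note e = elements_equivariant[OF w]
  have m: "symm (- 1) m" and pq: "adjacent p q" and qm: "adjacent q (m - q)"
    using quad by (auto simp: symmetric_4231_def)
  obtain i where i: "i \<in> alphabet W n" "pair_image (left W i) (right W n i) p q"
    using adjacent_pair_image[OF pq] .
  obtain j where j: "j \<in> alphabet W n" "pair_image (left W j) (right W n j) q (m - q)"
    using adjacent_pair_image[OF qm] .
  have s: "swaps (gen i) p q" by (rule swaps_image[OF swaps_generator[OF i(1)] i(2)])
  have t: "swaps (gen j) q (m - q)" by (rule swaps_image[OF swaps_generator[OF j(1)] j(2)])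
  have less: "p < q" "q < m - q" using pq qm by (auto simp: adjacent_def)
  have images: "gen i q = p" "gen j q = m - q"
    using s t by (simp_all add: swaps_def)
  then have moved: "gen i q \<noteq> q" "gen j q \<noteq> q" using less by simp_all
  have "i \<noteq> j" using images less by auto
  note chain = symmetric_4231_descents[OF e s t quad]
  note w1 = generator_in_elements[OF w]
  note w2 = generator_in_elements[OF w1]
  have "i \<in> {1..n - 1}"
  proof (rule ccontr)
    \<comment> \<open>otherwise a reflection exchanges \<open>p\<close> and \<open>q\<close>, so that \<open>w p + w q = p + q < m\<close>\<close>
    assume "i \<notin> {1..n - 1}"
    then have lr: "symm (- 1) (left W i + right W n i)"
      using end_letter_symmetric[OF _ i(1)] m by (auto simp: symmetry_def)
    have "period W n dvd p + q"
      using i(2) lr unfolding pair_image_def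
    proof (elim disjE exE conjE)
      fix k assume "symm 1 k" "p = left W i + k" "q = right W n i + k"
      then have "p + q = (left W i + right W n i) + 2 * k" "period W n dvd k"
        by (simp_all add: symmetry_def)
      then show ?thesis using lr by (simp add: symmetry_def del: add.assoc)
    next
      fix k assume "symm (- 1) k" "p = k - right W n i" "q = k - left W i"
      then have "p + q = 2 * k - (left W i + right W n i)" "period W n dvd k"
        by (simp_all add: symmetry_def)
      then show ?thesis using lr by (simp add: symmetry_def)
    qed
    then have "symm (- 1) (p + q)" using m by (simp add: symmetry_def)
    from equivariant_reflection[OF e this, of q] have "w p = p + q - w q" by simp
    moreover have "m - w p < w q"
      using quad equivariant_reflection[OF e m, of p] by (simp add: symmetric_4231_def)
    ultimately show False using less by simp
  qed
  then show thesis
    by (rule braid_reduced_word[OF w _ i(1) j(1) \<open>i \<noteq> j\<close> moved descent_at[OF w i(2) chain(1)]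
        descent_at[OF w1[OF i(1)] j(2) chain(2)] descent_at[OF w2[OF i(1) j(1)] i(2) chain(3)] that])
qed

text \<open>A braid in a reduced word survives appending a letter, so induction on the length
  reduces to elements in which undoing any descent destroys every 321.\<close>

lemma contains_321_imp_braid:
  assumes nd: "nondegenerate W n"
  shows "w \<in> elements W n \<Longrightarrow> contains_321 w \<Longrightarrow> \<exists>u. reduced_word W n u w \<and> \<not> braid_free W n u"
proof (induction "coxeter_length W n w" arbitrary: w rule: less_induct)
  case less
  note w = less.prems(1)
  show ?case
  proof (cases "\<exists>i\<in>alphabet W n. descent w i \<and> contains_321 (w \<circ> gen i)")
    case True
    then obtain i where i: "i \<in> alphabet W n" "descent w i" "contains_321 (w \<circ> gen i)" by blast
    have "coxeter_length W n (w \<circ> gen i) < coxeter_length W n w"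
      using coxeter_length_descent[OF w i(1,2)] by simp
    from less.hyps[OF this generator_in_elements[OF w i(1)] i(3)]
    obtain u where u: "reduced_word W n u (w \<circ> gen i)" "\<not> braid_free W n u" by blast
    have "reduced_word W n (u @ [i]) w" by (rule reduced_word_append[OF w i(1,2) u(1)])
    moreover have "\<not> braid_free W n (u @ [i])"
      using u(2) sublist_appendI[of u "[]" "[i]"] unfolding braid_free_def
      by (metis append_Nil sublist_order.order_trans)
    ultimately show ?thesis by blast
  next
    case False
    have "unbreakable w"
      unfolding unbreakable_def
    proof (intro allI impI, elim conjE)
      fix x y a b c assume xy: "adjacent x y" "w x > w y" and pat: "pattern_321 w a b c"
      obtain i where i: "i \<in> alphabet W n" "pair_image (left W i) (right W n i) x y"
        using adjacent_pair_image[OF xy(1)] .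
      have "\<not> contains_321 (w \<circ> gen i)" using False i(1) descent_at[OF w i(2) xy(2)] by blast
      then have "\<not> pattern_321 (w \<circ> gen i) (gen i a) (gen i b) (gen i c)"
        by (auto simp: contains_321_def)
      then show "pair_image x y a b \<or> pair_image x y b c"
        by (rule pattern_321_broken[OF swaps_image[OF swaps_generator[OF i(1)] i(2)] xy(1) pat])
    qed
    moreover obtain a b c where "pattern_321 w a b c" using less.prems(2) by (auto simp: contains_321_def)
    ultimately have "(\<exists>p q c. descending_triple w p q c) \<or> (\<exists>m p q. symmetric_4231 w m p q)"
      by (rule unbreakable_321[OF elements_compatible[OF w]])
    then show ?thesis
      using braid_of_triple[OF nd w] braid_of_symmetric_4231[OF nd w] by metis
  qed
qed

end

theorem theorem1p2:
  fixes W :: family and n :: nat and w :: "int \<Rightarrow> int"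
  assumes "admissible W n" and "w \<in> elements W n"
  shows "(real_of_int (disarray n w) / 2 = real (coxeter_length W n w) \<longleftrightarrow>
           (\<forall>u. reduced_word W n u w \<longrightarrow> copies_separated W n u)) \<and>
         ((\<forall>u. reduced_word W n u w \<longrightarrow> copies_separated W n u) \<longleftrightarrow>
           \<not> globally_contains_321 W n w) \<and>
         (nondegenerate W n \<longrightarrow>
           (\<not> globally_contains_321 W n w \<longleftrightarrow>
             (\<forall>u. reduced_word W n u w \<longrightarrow> braid_free W n u)))"
proof -
  interpret coxeter_family W n by unfold_locales (rule assms(1))
  let ?C = "\<not> globally_contains_321 W n w"
  have length_eq: "disarray n w = 2 * int (length u) \<longleftrightarrow> ?C" if "reduced_word W n u w" for u
    using reduced_word_disarray[OF that] by (simp add: contains_321_iff)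
  obtain u where u: "reduced_word W n u w" using ex_reduced_word[OF assms(2)] .
  have AC: "real_of_int (disarray n w) / 2 = real (coxeter_length W n w) \<longleftrightarrow> ?C"
    using length_eq[OF u] u by (auto simp: reduced_word_def field_simps)
  have CB: "copies_separated W n v" if ?C "reduced_word W n v w" for v
    using copies_separated_if_disarray[OF that(2)] length_eq[OF that(2)] that(1) by blast
  have BC: ?C if "nondegenerate W n" "\<forall>u. reduced_word W n u w \<longrightarrow> braid_free W n u"
    using contains_321_imp_braid[OF that(1) assms(2)] that(2) by (auto simp: contains_321_iff)
  \<comment> \<open>In the degenerate groups (C) holds outright, and (B) then follows from it by
    \<open>CB\<close>.\<close>
  have degenerate: ?C if "\<not> nondegenerate W n"
    using degenerate_no_321[OF that elements_compatible[OF assms(2)]]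
    by (simp add: contains_321_iff contains_321_def)
  show ?thesis
    using AC CB BC degenerate copies_separated_imp_braid_free by blast
qed

end
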